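(* Let $0<a<b$, let $A=\{x\in\mathbb{R}^2:a<|x|<b\}$, let $h_0$ satisfy (H1)--(H4) listed in the context, let $N\ge1$ be an integer, and let $u_*^N$ minimize $$I_0(u)=\int_A\tfrac12|\nabla u|^2+h_0(\det\nabla u)\,dx$$ in $\tilde{\mathcal{A}}_{N,\mathrm{sym}}$, written as $u_*^N(r,\theta)=\rho(r)e_r(\theta+\psi(r))$. Then the function $\frac{\rho}{r}$ attains no interior local maximum on $(a,b)$. In particular, the derivative $\frac{d}{dr}\left(\frac\rho r\right)$ changes sign only once, and $\frac ab\le\frac{\rho}{r}<1$ in $(a,b)$, with $\frac\rho r=1$ at $r=a$ and $r=b$.
   Context: $e_r(\theta)=(\cos\theta,\sin\theta)$; a dot denotes $d/dr$. Hypotheses on $h_0:\mathbb{R}\to[0,+\infty]$: (H1) $h_0$ is convex and $h_0\ge0$; (H2) $h_0\in C^3((0,+\infty))$ and for some positive constants $s,c_1,c_2,d_0$: $c_1t^{-s-j}\le(-1)^jh_0^{(j)}(t)\le c_2t^{-s-j}$ for $0<t<d_0$ and $j=0,1,2$; (H3) $h_0(t)=+\infty$ for $t\le0$; (H4) for some real number $\tau$ and positive constants $c_3,c_4,d_1$: $c_3t^\tau\le h_0''(t)\le c_4t^\tau$ for $t\ge d_1$. $\tilde{\mathcal{A}}_N$ is the set of $u\in W^{1,2}(A;\mathbb{R}^2)$ with $u=\mathrm{id}$ on $\partial A$ (in the sense of trace), $\det\nabla u\ge0$ a.e. in $A$, and $\mathrm{wind}\#\gamma_\theta=N$ for a.e.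 $\theta\in[0,2\pi]$, where in polar coordinates $\gamma_\theta(r)=u(r,\theta)/|u(r,\theta)|$, $a\le r\le b$. The winding number of a closed $C^1$ curve $\gamma=(x,y):[a,b]\to\mathbb{R}^2\setminus\{0\}$ is $\frac1{2\pi}\int_a^b\frac{xy'-x'y}{x^2+y^2}\,dr$, extended to closed continuous curves by approximation. $\tilde{\mathcal{A}}_{N,\mathrm{sym}}=\{u\in\tilde{\mathcal{A}}_N:u(x)=Q^Tu(Qx)\text{ for all }Q\in SO(2)\}$. It is known (Post and Sivaloganathan, 1997) that $\rho,\psi$ are of class $C^2(a,b)$ (and, under the present hypotheses, $\rho\in C([a,b])\cap C^3(a,b)$) and that $u_*^N$ solves the Euler-Lagrange equations, which for such maps read, with $d=\rho\dot\rho/r$ and a constant $\omega$: $[r\dot\rho+\rho h_0'(d)]'=\frac\rho r+r\rho\dot\psi^2+\dot\rho h_0'(d)$ and $r\rho^2\dot\psi=\omega$. *)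

theory Defs
  imports "HOL-Analysis.Analysis" "HOL-Complex_Analysis.Complex_Analysis"
begin

section \<open>Functions of one variable\<close>

text \<open>\<open>f\<close> is of class \<open>C\<^sup>k\<close> on the open set \<open>S\<close>.\<close>

definition Ck_on :: "nat \<Rightarrow> (real \<Rightarrow> real) \<Rightarrow> real set \<Rightarrow> bool" where
  "Ck_on k f S \<longleftrightarrow>
     (\<forall>j<k. \<forall>t\<in>S. (deriv ^^ j) f field_differentiable (at t)) \<and>
     (\<forall>j\<le>k. continuous_on S ((deriv ^^ j) f))"


section \<open>The stored-energy function\<close>

text \<open>The functions \<open>h\<^sub>0\<close> take values in \<open>[0,\<infinity>]\<close>, so nonnegativity is built into the type.
  Derivatives are those of the real-valued function below, and are only meaningful
  where \<open>h\<^sub>0\<close> is finite.\<close>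

definition fin :: "(real \<Rightarrow> ennreal) \<Rightarrow> real \<Rightarrow> real" where
  "fin h0 t = enn2real (h0 t)"

definition H1 :: "(real \<Rightarrow> ennreal) \<Rightarrow> bool" where
  "H1 h0 \<longleftrightarrow>
     (\<forall>x y l. 0 \<le> l \<and> l \<le> 1 \<longrightarrow>
        h0 ((1 - l) * x + l * y) \<le> ennreal (1 - l) * h0 x + ennreal l * h0 y)"

definition H2 :: "(real \<Rightarrow> ennreal) \<Rightarrow> bool" where
  "H2 h0 \<longleftrightarrow>
     (\<forall>t>0. h0 t < \<infinity>) \<and> Ck_on 3 (fin h0) {0<..} \<and>
     (\<exists>s c1 c2 d0. s > 0 \<and> c1 > 0 \<and> c2 > 0 \<and> d0 > 0 \<and>
        (\<forall>t j. 0 < t \<and> t < d0 \<and> j \<le> (2::nat) \<longrightarrow>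
           c1 * t powr (- s - real j) \<le> (-1) ^ j * (deriv ^^ j) (fin h0) t \<and>
           (-1) ^ j * (deriv ^^ j) (fin h0) t \<le> c2 * t powr (- s - real j)))"

definition H3 :: "(real \<Rightarrow> ennreal) \<Rightarrow> bool" where
  "H3 h0 \<longleftrightarrow> (\<forall>t\<le>0. h0 t = \<infinity>)"

definition H4 :: "(real \<Rightarrow> ennreal) \<Rightarrow> bool" where
  "H4 h0 \<longleftrightarrow>
     (\<exists>\<tau> c3 c4 d1. c3 > 0 \<and> c4 > 0 \<and> d1 > 0 \<and>
        (\<forall>t\<ge>d1. c3 * t powr \<tau> \<le> (deriv ^^ 2) (fin h0) t \<and>
                (deriv ^^ 2) (fin h0) t \<le> c4 * t powr \<tau>))"


section \<open>The Sobolev space \<open>W\<^sup>1\<^sup>,\<^sup>2\<close> of planar maps\<close>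

definition C1_map :: "(real^2 \<Rightarrow> 'a::real_normed_vector) \<Rightarrow> bool" where
  "C1_map f \<longleftrightarrow>
     (\<forall>x. f differentiable (at x)) \<and>
     (\<forall>j. continuous_on UNIV (\<lambda>x. frechet_derivative f (at x) (axis j 1)))"

text \<open>Testing with compactly supported \<open>C\<^sup>1\<close> functions gives the same weak
  derivatives as testing with \<open>C\<^sup>\<infinity>\<close> ones (mollify the test function).\<close>

definition test_functions :: "(real^2) set \<Rightarrow> (real^2 \<Rightarrow> real) set" where
  "test_functions A =
     {\<phi>. C1_map \<phi> \<and> (\<exists>K. compact K \<and> K \<subseteq> A \<and> (\<forall>x. x \<notin> K \<longrightarrow> \<phi> x = 0))}"

definition square_integrable :: "(real^2) set \<Rightarrow> (real^2 \<Rightarrow> 'a::euclidean_space) \<Rightarrow> bool" where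
  "square_integrable A f \<longleftrightarrow>
     f \<in> borel_measurable (lebesgue_on A) \<and> integrable (lebesgue_on A) (\<lambda>x. (norm (f x))\<^sup>2)"

text \<open>\<open>G x $ i $ j\<close> is the weak derivative of the component \<open>u x $ i\<close> in direction \<open>j\<close>.
  Requiring \<open>u\<close> and \<open>G\<close> to be square integrable, the maps that have a weak gradient
  in this sense are exactly those of class \<open>W\<^sup>1\<^sup>,\<^sup>2\<close>.\<close>

definition has_weak_gradient ::
  "(real^2) set \<Rightarrow> (real^2 \<Rightarrow> real^2) \<Rightarrow> (real^2 \<Rightarrow> real^2^2) \<Rightarrow> bool" where
  "has_weak_gradient A u G \<longleftrightarrow>
     square_integrable A u \<and> square_integrable A G \<and>
     (\<forall>\<phi>\<in>test_functions A. \<forall>i j.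
        (LINT x|lebesgue_on A. u x $ i * frechet_derivative \<phi> (at x) (axis j 1)) =
        - (LINT x|lebesgue_on A. G x $ i $ j * \<phi> x))"

definition W12 :: "(real^2) set \<Rightarrow> (real^2 \<Rightarrow> real^2) set" where
  "W12 A = {u. \<exists>G. has_weak_gradient A u G}"

text \<open>The weak gradient, unique up to null sets.\<close>

definition wgrad :: "(real^2) set \<Rightarrow> (real^2 \<Rightarrow> real^2) \<Rightarrow> real^2 \<Rightarrow> real^2^2" where
  "wgrad A u = (SOME G. has_weak_gradient A u G)"


section \<open>Polar coordinates and traces on an annulus\<close>

definition annulus :: "real \<Rightarrow> real \<Rightarrow> (real^2) set" where
  "annulus a b = {x. a < norm x \<and> norm x < b}"

definition e_r :: "real \<Rightarrow> real^2" where
  "e_r \<theta> = vector [cos \<theta>, sin \<theta>]"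

text \<open>\<open>g\<close> is the trace of \<open>u\<close>: the trace operator is the continuous extension, from
  \<open>C\<^sup>1\<close> maps up to the boundary to \<open>W\<^sup>1\<^sup>,\<^sup>2\<close>, of the restriction to \<open>\<partial>A\<close> with values in
  \<open>L\<^sup>2(\<partial>A)\<close>. The boundary consists of the circles of radius \<open>a\<close> and \<open>b\<close>; integrating in the
  angle instead of arc length only changes the norms by constant factors.\<close>

definition has_trace :: "real \<Rightarrow> real \<Rightarrow> (real^2 \<Rightarrow> real^2) \<Rightarrow> (real^2 \<Rightarrow> real^2) \<Rightarrow> bool" where
  "has_trace a b u g \<longleftrightarrow>
     (\<exists>v :: nat \<Rightarrow> real^2 \<Rightarrow> real^2.
        (\<forall>n. C1_map (v n)) \<and>
        (\<lambda>n. \<integral>\<^sup>+x. ennreal ((norm (v n x - u x))\<^sup>2 +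
               (norm (matrix (frechet_derivative (v n) (at x)) - wgrad (annulus a b) u x))\<^sup>2)
             \<partial>lebesgue_on (annulus a b)) \<longlonglongrightarrow> 0 \<and>
        (\<forall>R\<in>{a, b}.
           (\<lambda>n. \<integral>\<^sup>+\<theta>. ennreal ((norm (v n (R *\<^sub>R e_r \<theta>) - g (R *\<^sub>R e_r \<theta>)))\<^sup>2)
                \<partial>lebesgue_on {0..2*pi}) \<longlonglongrightarrow> 0))"


section \<open>Winding numbers and admissible maps\<close>

text \<open>For a closed \<open>C\<^sup>1\<close> curve \<open>\<gamma> = (x, y)\<close> avoiding \<open>0\<close>, the complex winding number
  \<open>1/(2\<pi>i) \<integral> dz/z\<close> about \<open>0\<close> is the integral of \<open>(x y' - x' y)/(x\<^sup>2 + y\<^sup>2)\<close> divided by \<open>2\<pi>\<close>;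
  the library extends it to continuous curves by approximation. Curves on \<open>[a,b]\<close> are
  reparametrised to \<open>[0,1]\<close>.\<close>

definition wind :: "real \<Rightarrow> real \<Rightarrow> (real \<Rightarrow> real^2) \<Rightarrow> complex" where
  "wind a b \<gamma> =
     winding_number (\<lambda>s. Complex (\<gamma> (a + s * (b - a)) $ 1) (\<gamma> (a + s * (b - a)) $ 2)) 0"

text \<open>For almost every \<open>\<theta>\<close> the map \<open>r \<mapsto> u(r,\<theta>)\<close> agrees almost everywhere with a (unique)
  continuous curve \<open>c\<close> on \<open>[a,b]\<close>, which is the one whose winding number is meant.\<close>

definition ray_winding :: "real \<Rightarrow> real \<Rightarrow> nat \<Rightarrow> (real^2 \<Rightarrow> real^2) \<Rightarrow> real \<Rightarrow> bool" where
  "ray_winding a b N u \<theta> \<longleftrightarrow>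
     (\<exists>c. continuous_on {a..b} c \<and> (\<forall>r\<in>{a..b}. c r \<noteq> 0) \<and>
          (AE r in lebesgue_on {a..b}. c r = u (r *\<^sub>R e_r \<theta>)) \<and>
          wind a b (\<lambda>r. c r /\<^sub>R norm (c r)) = of_nat N)"

definition admissible :: "real \<Rightarrow> real \<Rightarrow> nat \<Rightarrow> (real^2 \<Rightarrow> real^2) set" where
  "admissible a b N =
     {u. u \<in> W12 (annulus a b) \<and> has_trace a b u (\<lambda>x. x) \<and>
         (AE x in lebesgue_on (annulus a b). det (wgrad (annulus a b) u x) \<ge> 0) \<and>
         (AE \<theta> in lebesgue_on {0..2*pi}. ray_winding a b N u \<theta>)}"

definition admissible_sym :: "real \<Rightarrow> real \<Rightarrow> nat \<Rightarrow> (real^2 \<Rightarrow> real^2) set" where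
  "admissible_sym a b N =
     {u \<in> admissible a b N.
        \<forall>Q :: real^2^2. orthogonal_matrix Q \<and> det Q = 1 \<longrightarrow>
          (AE x in lebesgue_on (annulus a b). u x = transpose Q *v u (Q *v x))}"


section \<open>The energy and its symmetric minimizers\<close>

text \<open>The norm of \<open>real^2^2\<close> is the Frobenius norm.\<close>

definition energy :: "(real \<Rightarrow> ennreal) \<Rightarrow> real \<Rightarrow> real \<Rightarrow> (real^2 \<Rightarrow> real^2) \<Rightarrow> ennreal" where
  "energy h0 a b u =
     (\<integral>\<^sup>+x. ennreal (1/2 * (norm (wgrad (annulus a b) u x))\<^sup>2) + h0 (det (wgrad (annulus a b) u x))
        \<partial>lebesgue_on (annulus a b))"

definition sym_minimizer ::
  "(real \<Rightarrow> ennreal) \<Rightarrow> real \<Rightarrow> real \<Rightarrow> nat \<Rightarrow> (real^2 \<Rightarrow> real^2) \<Rightarrow> bool" where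
  "sym_minimizer h0 a b N u \<longleftrightarrow>
     u \<in> admissible_sym a b N \<and> (\<forall>v\<in>admissible_sym a b N. energy h0 a b u \<le> energy h0 a b v)"

text \<open>\<open>u(r,\<theta>) = \<rho>(r) e\<^sub>r(\<theta> + \<psi>(r))\<close> with modulus \<open>\<rho> \<ge> 0\<close>, for almost every point of the annulus.\<close>

definition polar_form ::
  "real \<Rightarrow> real \<Rightarrow> (real^2 \<Rightarrow> real^2) \<Rightarrow> (real \<Rightarrow> real) \<Rightarrow> (real \<Rightarrow> real) \<Rightarrow> bool" where
  "polar_form a b u \<rho> \<psi> \<longleftrightarrow>
     (\<forall>r\<in>{a<..<b}. \<rho> r \<ge> 0) \<and>
     (AE x in lebesgue_on (annulus a b).
        \<forall>\<theta>. x = norm x *\<^sub>R e_r \<theta> \<longrightarrow> u x = \<rho> (norm x) *\<^sub>R e_r (\<theta> + \<psi> (norm x)))"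

definition radial_det :: "(real \<Rightarrow> real) \<Rightarrow> real \<Rightarrow> real" where
  "radial_det \<rho> r = \<rho> r * deriv \<rho> r / r"

definition radial_Euler_Lagrange ::
  "(real \<Rightarrow> ennreal) \<Rightarrow> real \<Rightarrow> real \<Rightarrow> (real \<Rightarrow> real) \<Rightarrow> (real \<Rightarrow> real) \<Rightarrow> bool" where
  "radial_Euler_Lagrange h0 a b \<rho> \<psi> \<longleftrightarrow>
     (\<forall>r\<in>{a<..<b}.
        ((\<lambda>r. r * deriv \<rho> r + \<rho> r * deriv (fin h0) (radial_det \<rho> r)) has_real_derivative
          \<rho> r / r + r * \<rho> r * (deriv \<psi> r)\<^sup>2 + deriv \<rho> r * deriv (fin h0) (radial_det \<rho> r)) (at r)) \<and>
     (\<exists>\<omega>. \<forall>r\<in>{a<..<b}. r * (\<rho> r)\<^sup>2 * deriv \<psi> r = \<omega>)"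

definition local_max_at :: "(real \<Rightarrow> real) \<Rightarrow> real \<Rightarrow> bool" where
  "local_max_at f r0 \<longleftrightarrow> (\<forall>\<^sub>F r in at r0. f r \<le> f r0)"

end

theory Submission
  imports Defs "HOL-Real_Asymp.Real_Asymp"
begin

text \<open>
  At a critical point of \<open>\<sigma> = \<rho>/r\<close> one has \<open>r \<rho>' = \<rho>\<close>, and the expanded Euler-Lagrange equation
  \<open>r \<rho>'' + \<rho>' - \<rho>/r + \<rho> h\<^sub>0''(d) d' = \<omega>\<^sup>2/(r \<rho>\<^sup>3)\<close> collapses to
  \<open>\<rho>'' (r + \<rho> \<rho>' h\<^sub>0''(d)) = r \<rho> \<psi>'\<^sup>2\<close>. Convexity of \<open>h\<^sub>0\<close> and \<open>\<omega> \<noteq> 0\<close> then give \<open>\<sigma>'' = \<rho>''/r > 0\<close>, so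
  every critical point of \<open>\<sigma>\<close> is a strict local minimum; as \<open>\<sigma> = 1\<close> at both ends, there is exactly one.

  The equation may only be expanded where \<open>d > 0\<close>. Since \<open>h\<^sub>0'(t) \<rightarrow> -\<infinity>\<close> as \<open>t\<close> decreases to \<open>0\<close>, continuity of
  \<open>r \<rho>' + \<rho> h\<^sub>0'(d)\<close> makes \<open>{d > 0}\<close> relatively closed as well as open in \<open>(a,b)\<close>, and it is not empty because
  \<open>\<rho>(a) = a < b = \<rho>(b)\<close>. The boundary values come from the trace condition. The winding condition on a
  generic ray gives \<open>\<rho> > 0\<close>, and it excludes \<open>\<omega> = 0\<close>: constant \<open>\<psi>\<close> would make the ray's direction constant.
\<close>

no_notation fps_nth (infixl \<open>$\<close> 75)


section \<open>The radial Euler-Lagrange equation\<close>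

lemma Ck_on_deriv:
  assumes "Ck_on k f S" "j < k" "t \<in> S"
  shows "((deriv ^^ j) f has_real_derivative (deriv ^^ Suc j) f t) (at t)"
  using assms by (simp add: Ck_on_def field_differentiable_derivI)

lemma Ck_on_continuous:
  assumes "Ck_on k f S" "j \<le> k"
  shows "continuous_on S ((deriv ^^ j) f)"
  using assms by (simp add: Ck_on_def)

lemma H1_convex_on_fin:
  assumes "H1 h0" and fin: "\<And>t. t > 0 \<Longrightarrow> h0 t < \<infinity>"
  shows "convex_on {0<..} (fin h0)"
proof (rule convex_onI)
  have fin_nonneg: "0 \<le> fin h0 t" for t by (simp add: fin_def)
  fix l x y :: real assume l: "0 < l" "l < 1" and x: "x \<in> {0<..}" and y: "y \<in> {0<..}"
  have "h0 ((1 - l) * x + l * y) \<le> ennreal (1 - l) * h0 x + ennreal l * h0 y"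
    using assms(1) l unfolding H1_def by simp
  moreover have "h0 x = ennreal (fin h0 x)" "h0 y = ennreal (fin h0 y)"
    using fin[of x] fin[of y] x y by (auto simp: fin_def)
  ultimately have "h0 ((1 - l) * x + l * y) \<le> ennreal ((1 - l) * fin h0 x + l * fin h0 y)"
    using l fin_nonneg by (simp flip: ennreal_mult ennreal_plus)
  then show "fin h0 ((1 - l) *\<^sub>R x + l *\<^sub>R y) \<le> (1 - l) * fin h0 x + l * fin h0 y"
    using l fin_nonneg by (subst fin_def) (simp add: enn2real_leI)
qed (simp add: convex_real_interval)

text \<open>Adding the tangent line inequalities at two points shows that \<open>f'\<close> is
  nondecreasing on \<open>S\<close>, and a nondecreasing function has nonnegative
  derivatives.\<close>

lemma convex_on_second_deriv_nonneg:
  fixes f f' :: "real \<Rightarrow> real"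
  assumes S: "open S" "connected S" and conv: "convex_on S f"
    and f': "\<And>t. t \<in> S \<Longrightarrow> (f has_real_derivative f' t) (at t)"
    and f'': "(f' has_real_derivative D) (at t)" and "t \<in> S"
  shows "0 \<le> D"
proof (rule mono_on_imp_deriv_nonneg)
  have tangent: "f x - f c \<ge> f' c * (x - c)" if "x \<in> S" "c \<in> S" for x c
    using convex_on_imp_above_tangent[OF conv S(2)] that f'[of c] S(1)
    by (simp add: interior_open has_field_derivative_at_within)
  show "mono_on S f'"
  proof (rule mono_onI)
    fix x y assume xy: "x \<in> S" "y \<in> S" "x \<le> y"
    have "f' x * (y - x) \<le> f' y * (y - x)"
      using tangent[of x y] tangent[of y x] xy by (simp add: algebra_simps)
    then show "f' x \<le> f' y" using xy by (cases "x = y") auto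
  qed
qed (use assms in \<open>simp_all add: interior_open\<close>)

section \<open>Positivity of the determinant\<close>

text \<open>The case \<open>j = 1\<close> of \<open>H2\<close> bounds \<open>-h0'\<close> below by
  \<open>c1 * t powr (- s - 1)\<close>. This blow-up is what keeps \<open>radial_det\<close> from
  reaching \<open>0\<close>.\<close>

lemma H2_deriv_at_bot:
  assumes "H2 h0"
  shows "filterlim (deriv (fin h0)) at_bot (at_right 0)"
proof -
  obtain s c1 c2 d0 :: real where sc: "s > 0" "c1 > 0" "d0 > 0" and
    bound: "\<And>t j. \<lbrakk>0 < t; t < d0; j \<le> (2::nat)\<rbrakk> \<Longrightarrow>
      c1 * t powr (- s - real j) \<le> (-1) ^ j * (deriv ^^ j) (fin h0) t"
    using assms unfolding H2_def by metis
  have "\<forall>\<^sub>F t in at_right 0. deriv (fin h0) t \<le> - (c1 * t powr (- s - 1))"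
    unfolding eventually_at_right_field
    using sc bound[of _ 1] by (intro exI[of _ d0]) fastforce
  moreover have "filterlim (\<lambda>t. - (c1 * t powr (- s - 1))) at_bot (at_right 0)"
    using sc by real_asymp
  ultimately show ?thesis
    by (rule filterlim_at_bot_mono[rotated])
qed

text \<open>
  Where \<open>radial_det \<rho> r \<le> 0\<close> the term \<open>deriv (fin h0) (radial_det \<rho> r)\<close> is a junk value; the proof uses
  continuity only along points with \<open>radial_det \<rho> r > 0\<close>.
\<close>

lemma Euler_Lagrange_imp_radial_det_pos:
  fixes a b :: real
  assumes ab: "a < b" "0 < a" and H2: "H2 h0" and cont: "continuous_on {a..b} \<rho>"
    and C3: "Ck_on 3 \<rho> {a<..<b}"
    and F: "\<And>r. r \<in> {a<..<b} \<Longrightarrow>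
       isCont (\<lambda>r. r * deriv \<rho> r + \<rho> r * deriv (fin h0) (radial_det \<rho> r)) r"
    and pos: "\<And>r. r \<in> {a<..<b} \<Longrightarrow> \<rho> r > 0"
    and bdry: "\<rho> a < \<rho> b" and r: "r \<in> {a<..<b}"
  shows "radial_det \<rho> r > 0"
proof -
  define d where "d = radial_det \<rho>"
  have D: "(\<rho> has_real_derivative deriv \<rho> r) (at r)" if "r \<in> {a<..<b}" for r
    using Ck_on_deriv[OF C3, of 0 r] that by simp
  have cont\<rho>': "continuous_on {a<..<b} (deriv \<rho>)"
    using Ck_on_continuous[OF C3, of 1] by simp
  have cont\<rho>: "continuous_on {a<..<b} \<rho>"
    using cont by (rule continuous_on_subset) auto
  have contd: "continuous_on {a<..<b} d"
    unfolding d_def radial_det_def using ab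
    by (intro continuous_intros cont\<rho> cont\<rho>') auto
  let ?I = "{a<..<b}" and ?P = "{r \<in> {a<..<b}. d r > 0}"
  have "openin (top_of_set ?I) ?P"
    using continuous_openin_preimage_gen[OF contd, of "{0<..}"]
    by (simp add: vimage_def Int_def)
  moreover have "closedin (top_of_set ?I) ?P"
    unfolding closedin_limpt
  proof (intro conjI allI impI, blast)
    fix x assume x: "x islimpt ?P \<and> x \<in> ?I"
    let ?F = "at x within ?P"
    have F_nontriv: "?F \<noteq> bot" using x trivial_limit_within by blast
    have at: "(f \<longlongrightarrow> f x) ?F" if "continuous_on ?I f" for f :: "real \<Rightarrow> real"
      by (rule tendsto_within_subset[of _ _ _ ?I]) (use that x in \<open>auto simp: continuous_on_def\<close>)
    have inP: "\<forall>\<^sub>F r in ?F. r \<in> ?P"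
      by (simp add: eventually_at_filter)
    have "0 \<le> d x"
      using tendsto_lowerbound[OF at[OF contd] _ F_nontriv] inP
      by (metis (mono_tags, lifting) eventually_mono less_imp_le mem_Collect_eq)
    moreover have "d x \<noteq> 0"
    proof
      assume "d x = 0"
      \<comment> \<open>Since \<open>d > 0\<close> on \<open>?P\<close>, it approaches
        \<open>0\<close> from the right along \<open>?F\<close>, the side on which \<open>H2\<close>
        gives information.\<close>
      then have "filterlim d (at_right 0) ?F"
        using at[OF contd] inP by (auto simp: filterlim_at elim: eventually_mono)
      then have "filterlim (\<lambda>r. deriv (fin h0) (d r)) at_bot ?F"
        using H2_deriv_at_bot[OF H2] filterlim_compose by blast
      then have inf: "filterlim (\<lambda>r. deriv (fin h0) (d r)) at_infinity ?F"
        by (rule filterlim_mono[OF _ at_bot_le_at_infinity order_refl])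
      \<comment> \<open>Solving the continuous bracket for \<open>h0'(d)\<close> exhibits a finite
        limit at \<open>x\<close>, as \<open>\<rho> x > 0\<close>. This contradicts the divergence
        just shown.\<close>
      define \<Phi> where "\<Phi> = (\<lambda>r. r * deriv \<rho> r + \<rho> r * deriv (fin h0) (d r))"
      have "continuous_on ?I \<Phi>"
        using F unfolding \<Phi>_def d_def by (simp add: continuous_at_imp_continuous_on)
      then have "((\<lambda>r. (\<Phi> r - r * deriv \<rho> r) / \<rho> r) \<longlongrightarrow> (\<Phi> x - x * deriv \<rho> x) / \<rho> x) ?F"
        using pos[of x] x by (intro at continuous_intros cont\<rho> cont\<rho>' tendsto_intros) auto
      moreover have "\<forall>\<^sub>F r in ?F. (\<Phi> r - r * deriv \<rho> r) / \<rho> r = deriv (fin h0) (d r)"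
        using inP by eventually_elim (use pos in \<open>force simp: \<Phi>_def\<close>)
      ultimately have "((\<lambda>r. deriv (fin h0) (d r)) \<longlongrightarrow> (\<Phi> x - x * deriv \<rho> x) / \<rho> x) ?F"
        by (simp add: tendsto_cong)
      with inf show False
        using not_tendsto_and_filterlim_at_infinity[OF F_nontriv] by blast
    qed
    ultimately show "x \<in> ?P" using x by simp
  qed
  ultimately have "?P = {} \<or> ?P = ?I"
    using connected_clopen[of ?I] connected_Ioo[of a b] by blast
  moreover have "?P \<noteq> {}"
  proof
    assume empty: "?P = {}"
    have "deriv \<rho> x \<le> 0" if "x \<in> ?I" for x
    proof -
      have "d x \<le> 0" using empty that by force
      then show ?thesis
        using pos[OF that] that ab by (auto simp: d_def radial_det_def divide_le_0_iff mult_le_0_iff)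
    qed
    then have "\<rho> b \<le> \<rho> a"
      using D cont ab by (intro DERIV_nonpos_imp_decreasing_open[of a b \<rho>]) force+
    with bdry show False by simp
  qed
  ultimately have "r \<in> ?P" using r by blast
  then show ?thesis by (simp add: d_def)
qed

section \<open>Functions whose critical points are all strict minima\<close>

text \<open>Zero can only be crossed upwards: at a first return from positive values to
  \<open>0\<close>, the derivative could not be positive.\<close>

lemma pos_deriv_at_zeros_imp_single_sign_change:
  fixes g g' :: "real \<Rightarrow> real"
  assumes g': "\<And>t. t \<in> {a<..<b} \<Longrightarrow> (g has_real_derivative g' t) (at t)"
    and zero: "\<And>t. \<lbrakk>t \<in> {a<..<b}; g t = 0\<rbrakk> \<Longrightarrow> g' t > 0"
    and xy: "a < x" "x < y" "y < b" and gx: "g x \<ge> 0"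
  shows "g y > 0"
proof (rule ccontr)
  assume gy: "\<not> g y > 0"
  \<comment> \<open>If \<open>g x = 0\<close>, the positive derivative makes \<open>g\<close>
    strictly positive just to the right of \<open>x\<close>.\<close>
  obtain x' where x': "x \<le> x'" "x' < y" "g x' > 0"
  proof (cases "g x = 0")
    case True
    then obtain e where "e > 0" "\<And>h. \<lbrakk>h > 0; h < e\<rbrakk> \<Longrightarrow> g x < g (x + h)"
      using DERIV_pos_inc_right[OF g'[of x]] zero[of x] xy by auto
    moreover obtain h where "0 < h" "h < min e (y - x)"
      using dense[of 0 "min e (y - x)"] xy \<open>e > 0\<close> by auto
    ultimately show ?thesis
      using True that[of "x + h"] by auto
  qed (use gx xy that[of x] in auto)
  \<comment> \<open>The least point \<open>z\<close> of this compact set is the first return of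
    \<open>g\<close> to nonpositive values.\<close>
  define Z where "Z = {t \<in> {x'..y}. g t \<le> 0}"
  have "continuous_on {x'..y} g"
    using x' xy by (intro continuous_at_imp_continuous_on ballI DERIV_isCont[OF g']) auto
  then have "closed Z"
    unfolding Z_def by (intro continuous_on_closed_Collect_le continuous_intros) auto
  then have "compact Z"
    by (auto simp: compact_eq_bounded_closed Z_def intro: bounded_subset[OF bounded_closed_interval])
  moreover have "Z \<noteq> {}" using gy x' by (auto simp: Z_def)
  ultimately obtain z where z: "z \<in> Z" "\<And>t. t \<in> Z \<Longrightarrow> z \<le> t"
    using compact_attains_inf[of Z] by blast
  have "x' \<le> z" and zx: "z \<le> y" "g z \<le> 0" using z(1) by (auto simp: Z_def)
  then have "x' < z" using x'(3) by (cases "x' = z") auto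
  \<comment> \<open>By the intermediate value theorem \<open>g\<close> vanishes somewhere in
    \<open>{x'..z}\<close>, and by minimality this can only happen at \<open>z\<close>.\<close>
  have "g z = 0"
  proof (rule ccontr)
    assume "g z \<noteq> 0"
    have "continuous_on {x'..z} g"
      using \<open>continuous_on {x'..y} g\<close> by (rule continuous_on_subset) (use zx(1) in simp)
    then obtain w where "x' \<le> w" "w \<le> z" "g w = 0"
      using IVT2'[of g z 0 x', OF zx(2) less_imp_le[OF x'(3)] \<open>x' \<le> z\<close>] by blast
    then have "z \<le> w" using z(2)[of w] zx(1) by (simp add: Z_def)
    then have "w = z" using \<open>w \<le> z\<close> by simp
    then show False using \<open>g w = 0\<close> \<open>g z \<noteq> 0\<close> by simp
  qed
  \<comment> \<open>As \<open>g' z > 0\<close>, \<open>g\<close> is negative just to the left of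
    \<open>z\<close>, which gives \<open>Z\<close> an element below \<open>z\<close>.\<close>
  then obtain e where e: "e > 0" "\<And>h. \<lbrakk>h > 0; h < e\<rbrakk> \<Longrightarrow> g (z - h) < g z"
    using DERIV_pos_inc_left[OF g'[of z]] zero[of z] xy zx x' \<open>x' < z\<close> by auto
  obtain h where "0 < h" "h < min e (z - x')"
    using dense[of 0 "min e (z - x')"] e(1) \<open>x' < z\<close> by auto
  then show False
    using e(2)[of h] z(2)[of "z - h"] zx(1) \<open>g z = 0\<close> by (simp add: Z_def)
qed

text \<open>Rolle's theorem gives a critical point \<open>r0\<close>. Since \<open>f'\<close>
  crosses zero only upwards, \<open>f\<close> strictly decreases before \<open>r0\<close> and
  strictly increases after it; all three claims follow.\<close>

lemma pos_second_deriv_at_critical_points_shape: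
  fixes f f' f'' :: "real \<Rightarrow> real"
  assumes "a < b" and cont: "continuous_on {a..b} f" and eq: "f a = f b"
    and f': "\<And>t. t \<in> {a<..<b} \<Longrightarrow> (f has_real_derivative f' t) (at t)"
    and f'': "\<And>t. t \<in> {a<..<b} \<Longrightarrow> (f' has_real_derivative f'' t) (at t)"
    and crit: "\<And>t. \<lbrakk>t \<in> {a<..<b}; f' t = 0\<rbrakk> \<Longrightarrow> f'' t > 0"
  shows "\<exists>r0\<in>{a<..<b}. (\<forall>r\<in>{a<..<r0}. f' r < 0) \<and> (\<forall>r\<in>{r0<..<b}. f' r > 0)"
    and "\<And>r. r \<in> {a<..<b} \<Longrightarrow> f r < f a"
    and "\<And>r. r \<in> {a<..<b} \<Longrightarrow> \<not> local_max_at f r"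
proof -
  \<comment> \<open>Rolle's theorem is stated for the derivative as a linear map; evaluation at
    \<open>1\<close> turns it into \<open>f' r0 = 0\<close>.\<close>
  have "\<exists>r0. a < r0 \<and> r0 < b \<and> (*) (f' r0) = (\<lambda>v. 0)"
    using f' by (intro Rolle_deriv[OF \<open>a < b\<close> eq cont]) (simp add: has_field_derivative_def)
  then obtain r0 where r0: "a < r0" "r0 < b" "f' r0 = 0"
    by (metis mult.right_neutral)
  have sign: "f' y > 0" if "a < x" "x < y" "y < b" "f' x \<ge> 0" for x y
    using f'' crit that by (rule pos_deriv_at_zeros_imp_single_sign_change)
  have right: "f' r > 0" if "r \<in> {r0<..<b}" for r
    using sign[of r0 r] that r0 by auto
  have left: "f' r < 0" if "r \<in> {a<..<r0}" for r
    using sign[of r r0] that r0 by force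
  show "\<exists>r0\<in>{a<..<b}. (\<forall>r\<in>{a<..<r0}. f' r < 0) \<and> (\<forall>r\<in>{r0<..<b}. f' r > 0)"
    using left right r0 by (intro bexI[of _ r0]) auto
  have cont_sub: "continuous_on {x..y} f" if "a \<le> x" "y \<le> b" for x y
    using cont by (rule continuous_on_subset) (use that in auto)
  have dec: "f y < f x" if "a \<le> x" "x < y" "y \<le> r0" for x y
  proof (rule DERIV_neg_imp_decreasing_open[OF \<open>x < y\<close>])
    show "\<exists>D. (f has_real_derivative D) (at t) \<and> D < 0" if "x < t" "t < y" for t
      using f'[of t] left[of t] that \<open>a \<le> x\<close> \<open>y \<le> r0\<close> r0 by auto
  qed (use cont_sub that r0 in auto)
  have inc: "f x < f y" if "r0 \<le> x" "x < y" "y \<le> b" for x y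
  proof (rule DERIV_pos_imp_increasing_open[OF \<open>x < y\<close>])
    show "\<exists>D. (f has_real_derivative D) (at t) \<and> D > 0" if "x < t" "t < y" for t
      using f'[of t] right[of t] that \<open>r0 \<le> x\<close> \<open>y \<le> b\<close> r0 by auto
  qed (use cont_sub that r0 in auto)
  show "f r < f a" if "r \<in> {a<..<b}" for r
    using that dec[of a r] inc[of r b] eq by (cases "r \<le> r0") auto
  show "\<not> local_max_at f r" if r: "r \<in> {a<..<b}" for r
  proof
    assume "local_max_at f r"
    then obtain e where e: "e > 0" "\<And>y. \<lbrakk>y \<noteq> r; dist y r < e\<rbrakk> \<Longrightarrow> f y \<le> f r"
      unfolding local_max_at_def eventually_at by auto
    \<comment> \<open>A step of length \<open>h\<close> stays in the interval and in the
      neighbourhood. Moving away from \<open>r0\<close>, or to the right if \<open>r = r0\<close>,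
      strictly increases \<open>f\<close>.\<close>
    obtain h where "0 < h" "h < min e (min (r - a) (b - r))"
      using dense[of 0 "min e (min (r - a) (b - r))"] e(1) r by auto
    then have h: "h > 0" "h < e" "a < r - h" "r + h < b" by auto
    show False
    proof (cases "r < r0")
      case True
      then show ?thesis using e(2)[of "r - h"] dec[of "r - h" r] h by (auto simp: dist_real_def)
    next
      case False
      then show ?thesis using e(2)[of "r + h"] inc[of r "r + h"] h by (auto simp: dist_real_def)
    qed
  qed
qed

section \<open>The sign of the second derivative at critical points\<close>

lemma Euler_Lagrange_second_deriv_pos:
  fixes r :: real
  assumes r: "r > 0" and d_pos: "radial_det \<rho> r > 0" and "\<rho> r > 0"
    and D1: "\<forall>\<^sub>F t in nhds r. (\<rho> has_real_derivative deriv \<rho> t) (at t)"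
    and D2: "(deriv \<rho> has_real_derivative \<rho>'') (at r)"
    and h': "(deriv (fin h0) has_real_derivative h'') (at (radial_det \<rho> r))" and "h'' \<ge> 0"
    and EL: "((\<lambda>r. r * deriv \<rho> r + \<rho> r * deriv (fin h0) (radial_det \<rho> r)) has_real_derivative
          \<rho> r / r + r * \<rho> r * (deriv \<psi> r)\<^sup>2 + deriv \<rho> r * deriv (fin h0) (radial_det \<rho> r)) (at r)"
    and crit: "r * deriv \<rho> r = \<rho> r" and "deriv \<psi> r \<noteq> 0"
  shows "\<rho>'' > 0"
proof -
  have D: "(\<rho> has_real_derivative deriv \<rho> r) (at r)"
    using D1 by (rule eventually_nhds_x_imp_x)
  \<comment> \<open>In general \<open>d' = (\<rho>'^2 + \<rho> \<rho>'') / r - \<rho> \<rho>' /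
    r^2\<close>. With \<open>r \<rho>' = \<rho>\<close> the first and last terms cancel and the
    middle one is \<open>\<rho>' \<rho>''\<close>.\<close>
  have d': "(radial_det \<rho> has_real_derivative deriv \<rho> r * \<rho>'') (at r)"
    unfolding radial_det_def using r
    by (auto intro!: derivative_eq_intros D D2 simp: crit[symmetric] power2_eq_square field_simps)
  have "((\<lambda>r. r * deriv \<rho> r + \<rho> r * deriv (fin h0) (radial_det \<rho> r)) has_real_derivative
      deriv \<rho> r + r * \<rho>'' + deriv \<rho> r * deriv (fin h0) (radial_det \<rho> r)
        + \<rho> r * (h'' * (deriv \<rho> r * \<rho>''))) (at r)"
    using DERIV_chain2[OF h' d'] D D2 by (auto intro!: derivative_eq_intros)
  \<comment> \<open>Equating the two derivatives, the terms \<open>\<rho>' h0'(d)\<close> cancel,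
    and so do \<open>\<rho>'\<close> and \<open>\<rho> / r\<close>.\<close>
  from DERIV_unique[OF this EL]
  have "\<rho>'' * (r + \<rho> r * h'' * deriv \<rho> r) = r * \<rho> r * (deriv \<psi> r)\<^sup>2"
    using r by (simp add: crit[symmetric] algebra_simps)
  moreover have "r * \<rho> r * (deriv \<psi> r)\<^sup>2 > 0" using assms by simp
  moreover have "deriv \<rho> r > 0" using crit r \<open>\<rho> r > 0\<close> by (metis zero_less_mult_pos)
  ultimately show ?thesis
    using r \<open>\<rho> r > 0\<close> \<open>h'' \<ge> 0\<close>
    by (metis add_pos_nonneg less_imp_le mult_nonneg_nonneg zero_less_mult_pos2)
qed


section \<open>Polar coordinates\<close>

lemma e_r_nth [simp]: "e_r \<theta> $ 1 = cos \<theta>" "e_r \<theta> $ 2 = sin \<theta>"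
  by (simp_all add: e_r_def)

lemma norm_e_r [simp]: "norm (e_r \<theta>) = 1"
  by (simp add: norm_eq_sqrt_inner inner_vec_def sum_2 flip: power2_eq_square)

lemma vector_2_axis: "(vector [x, y] :: real^2) = x *\<^sub>R axis 1 1 + y *\<^sub>R axis 2 1"
  by (simp add: vec_eq_iff forall_2 axis_def)

lemma annulus_borel [measurable, simp]: "annulus a b \<in> sets borel"
  by (simp add: annulus_def)

text \<open>The two measures agree on boxes. This links Fubini's theorem, available on pairs, with
  the change of variables on \<open>real^2\<close>.\<close>

lemma lborel_vec2_eq_distr:
  "(lborel :: (real^2) measure) = distr (lborel \<Otimes>\<^sub>M lborel) borel (\<lambda>p. vector [fst p, snd p])"
proof (rule lborel_eqI)
  fix l u :: "real^2" assume le: "\<And>b. b \<in> Basis \<Longrightarrow> l \<bullet> b \<le> u \<bullet> b"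
  have le': "l $ 1 \<le> u $ 1" "l $ 2 \<le> u $ 2"
    using le[of "axis 1 1"] le[of "axis 2 1"] by (auto simp: inner_axis)
  have "(\<lambda>p. vector [fst p, snd p] :: real^2) \<in> borel_measurable (lborel \<Otimes>\<^sub>M lborel)"
    unfolding vector_2_axis by measurable
  moreover have "(\<lambda>p. vector [fst p, snd p]) -` box l u = {l$1<..<u$1} \<times> {l$2<..<u$2}"
    by (auto simp: mem_box_cart forall_2)
  ultimately have "emeasure (distr (lborel \<Otimes>\<^sub>M lborel) borel (\<lambda>p. vector [fst p, snd p])) (box l u)
      = ennreal (u$1 - l$1) * ennreal (u$2 - l$2)"
    using le' by (simp add: emeasure_distr space_pair_measure lborel.emeasure_pair_measure_Times)
  also have "\<dots> = ennreal (\<Prod>b\<in>Basis. (u - l) \<bullet> b)"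
  proof -
    have "(\<Prod>b\<in>Basis. (u - l) \<bullet> b) = (u$1 - l$1) * (u$2 - l$2)"
      by (simp add: Basis_vec_def UNIV_2 inner_axis axis_eq_axis)
    then show ?thesis using le' by (simp add: ennreal_mult)
  qed
  finally show "emeasure (distr (lborel \<Otimes>\<^sub>M lborel) borel (\<lambda>p. vector [fst p, snd p])) (box l u)
      = ennreal (\<Prod>b\<in>Basis. (u - l) \<bullet> b)" .
qed simp

text \<open>A self-map of \<open>real^2\<close> rather than a map on pairs, so that the Jacobian is
  the determinant of a square matrix.\<close>

definition polar_map :: "real^2 \<Rightarrow> real^2" where
  "polar_map y = y $ 1 *\<^sub>R e_r (y $ 2)"

definition polar_deriv :: "real^2 \<Rightarrow> real^2 \<Rightarrow> real^2" where
  "polar_deriv y h = h $ 1 *\<^sub>R e_r (y $ 2) + (y $ 1 * h $ 2) *\<^sub>R vector [- sin (y $ 2), cos (y $ 2)]"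

text \<open>Excluding the angles \<open>0\<close> and \<open>2 * pi\<close> makes
  \<open>polar_map\<close> injective at the cost of a null segment of the annulus.\<close>

definition polar_box :: "real \<Rightarrow> real \<Rightarrow> (real^2) set" where
  "polar_box a b = {y. a < y $ 1 \<and> y $ 1 < b \<and> 0 < y $ 2 \<and> y $ 2 < 2 * pi}"

lemma polar_box_eq_box: "polar_box a b = box (vector [a, 0]) (vector [b, 2 * pi])"
  by (auto simp: polar_box_def mem_box_cart forall_2)

lemma polar_map_has_derivative:
  "(polar_map has_derivative polar_deriv y) (at y within S)"
proof -
  have c: "((\<lambda>y::real^2. y $ i) has_derivative (\<lambda>h. h $ i)) (at y within S)" for i
    by (rule bounded_linear_imp_has_derivative[OF bounded_linear_vec_nth])
  have "((\<lambda>y. (y $ 1 * cos (y $ 2)) *\<^sub>R axis 1 1 + (y $ 1 * sin (y $ 2)) *\<^sub>R axis 2 1) has_derivative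
     (\<lambda>h. (h $ 1 * cos (y $ 2) - y $ 1 * h $ 2 * sin (y $ 2)) *\<^sub>R axis 1 1
        + (h $ 1 * sin (y $ 2) + y $ 1 * h $ 2 * cos (y $ 2)) *\<^sub>R axis 2 (1::real) :: real^2)) (at y within S)"
    by (auto intro!: derivative_eq_intros c simp: algebra_simps)
  then show ?thesis
    by (simp add: polar_map_def[abs_def] polar_deriv_def[abs_def] e_r_def vector_2_axis algebra_simps)
qed

lemma polar_map_measurable [measurable]: "polar_map \<in> borel_measurable borel"
proof (rule borel_measurable_continuous_onI)
  show "continuous_on UNIV polar_map"
    using polar_map_has_derivative has_derivative_continuous_on by blast
qed

lemma norm_polar_map [simp]: "norm (polar_map y) = \<bar>y $ 1\<bar>"
  by (simp add: polar_map_def)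

lemma inj_on_polar_map:
  assumes "0 \<le> a"
  shows "inj_on polar_map (polar_box a b)"
proof (rule inj_onI)
  fix y z assume yz: "y \<in> polar_box a b" "z \<in> polar_box a b" and eq: "polar_map y = polar_map z"
  have 1: "y $ 1 = z $ 1" "y $ 1 > 0"
    using arg_cong[OF eq, of norm] yz assms by (auto simp: polar_box_def)
  then have "sin (y $ 2) = sin (z $ 2)" "cos (y $ 2) = cos (z $ 2)"
    using arg_cong[OF eq, of "\<lambda>x. x $ 2"] arg_cong[OF eq, of "\<lambda>x. x $ 1"] by (auto simp: polar_map_def)
  then obtain n :: int where n: "y $ 2 = z $ 2 + 2 * pi * n"
    using sin_cos_eq_iff by blast
  have "\<bar>2 * pi * n\<bar> < 2 * pi * 1"
    using n yz by (auto simp: polar_box_def)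
  then have "\<bar>real_of_int n\<bar> < 1"
    by (simp add: abs_mult)
  then have "n = 0" by linarith
  then show "y = z" using n 1 by (simp add: vec_eq_iff forall_2)
qed

text \<open>The Jacobian of \<open>polar_map\<close> is the radius, which exceeds \<open>a\<close>
  on the box. Hence the image of the preimage of \<open>B\<close>, contained in \<open>B\<close> and
  in the annulus, has at least \<open>a\<close> times its area.\<close>

lemma emeasure_polar_map_vimage_le:
  assumes a: "0 < a" and B: "B \<in> sets borel"
  shows "ennreal a * emeasure lborel (polar_map -` B \<inter> polar_box a b) \<le> emeasure lborel (B \<inter> annulus a b)"
proof -
  define T where "T = polar_map -` B \<inter> polar_box a b"
  \<comment> \<open>The integral of the Jacobian over \<open>T\<close>, that is, the area of the
    image of \<open>T\<close>.\<close>
  define m where "m = (LINT y|lborel. indicator T y *\<^sub>R y $ 1)"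
  have box: "polar_box a b \<in> sets borel" by (simp add: polar_box_eq_box)
  have T: "T \<in> sets lborel"
    using measurable_sets[OF polar_map_measurable B] box by (simp add: T_def)
  have "emeasure lborel T \<le> emeasure lborel (polar_box a b)"
    using box by (intro emeasure_mono) (auto simp: T_def)
  also have "\<dots> < \<infinity>" unfolding polar_box_eq_box
    by (rule emeasure_bounded_finite) (rule bounded_box)
  finally have fin: "emeasure lborel T < \<infinity>" .
  have int: "integrable lborel (\<lambda>y. indicator T y *\<^sub>R y $ 1)"
    using T fin a by (intro integrableI_bounded_set_indicator[where B=b]) (auto simp: T_def polar_box_def)
  have int1: "integrable lborel (\<lambda>y. indicator T y *\<^sub>R a)"
    using T fin by (intro integrableI_bounded_set_indicator[where B=a]) (use a in auto)
  have "((\<lambda>y. indicator T y *\<^sub>R y $ 1) has_integral m) UNIV"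
    unfolding m_def by (rule has_integral_integral_lborel[OF int])
  moreover have "(\<lambda>y. indicator T y *\<^sub>R y $ 1) = (\<lambda>y. if y \<in> T then y $ 1 else 0)"
    by (auto simp: indicator_def)
  ultimately have "((\<lambda>y. y $ 1) has_integral m) T"
    by (simp add: has_integral_restrict_UNIV)
  moreover have "\<bar>det (matrix (polar_deriv y))\<bar> = y $ 1"
    if "y \<in> T" for y
  proof -
    have "det (matrix (polar_deriv y))
        = y $ 1 * (sin (y $ 2) ^ 2 + cos (y $ 2) ^ 2)"
      by (simp add: polar_deriv_def det_2 matrix_def axis_def distrib_left power2_eq_square)
    then show ?thesis using that a by (simp add: T_def polar_box_def)
  qed
  ultimately have "((\<lambda>y. \<bar>det (matrix (polar_deriv y))\<bar>)
      has_integral m) T"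
    by (simp cong: has_integral_cong)
  moreover have "inj_on polar_map T"
    using inj_on_polar_map[of a b] a by (auto simp: T_def intro: inj_on_subset)
  ultimately have image: "polar_map ` T \<in> lmeasurable" "measure lebesgue (polar_map ` T) = m"
    using has_measure_differentiable_image[of T polar_map _ m] polar_map_has_derivative T by auto
  have "a * measure lborel T = (LINT y|lborel. indicator T y *\<^sub>R a)"
    by simp
  also have "\<dots> \<le> m"
    unfolding m_def by (intro integral_mono int int1) (auto simp: T_def polar_box_def indicator_def)
  finally have "a * measure lborel T \<le> m" .
  have "ennreal a * emeasure lborel T = ennreal (a * measure lborel T)"
    using fin a by (simp add: emeasure_eq_ennreal_measure ennreal_mult)
  also have "\<dots> \<le> ennreal m"
    using \<open>a * measure lborel T \<le> m\<close> by (rule ennreal_leI)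
  also have "\<dots> = emeasure lebesgue (polar_map ` T)"
    by (simp only: emeasure_eq_measure2[OF image(1)] image(2))
  also have "\<dots> \<le> emeasure lebesgue (B \<inter> annulus a b)"
    using B a by (intro emeasure_mono) (auto simp: T_def annulus_def polar_box_def)
  also have "\<dots> = emeasure lborel (B \<inter> annulus a b)"
    using sets.Int[OF B annulus_borel] by (simp add: emeasure_completion)
  finally show ?thesis by (simp add: T_def)
qed


text \<open>The estimate for sets is an inequality \<open>M \<le> N\<close> between measures:
  \<open>a\<close> times the image of Lebesgue measure on the polar box, and Lebesgue measure on the
  annulus. Integrating \<open>f\<close> against both gives the claim.\<close>

lemma nn_integral_polar_le:
  fixes f :: "real^2 \<Rightarrow> ennreal"
  assumes a: "0 < a" and f [measurable]: "f \<in> borel_measurable borel"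
  shows "ennreal a * (\<integral>\<^sup>+\<theta>. \<integral>\<^sup>+r. f (r *\<^sub>R e_r \<theta>) * indicator {a<..<b} r * indicator {0<..<2*pi} \<theta> \<partial>lborel \<partial>lborel)
    \<le> (\<integral>\<^sup>+x\<in>annulus a b. f x \<partial>lborel)"
proof -
  have [measurable]: "polar_box a b \<in> sets borel"
    by (simp add: polar_box_eq_box)
  define M where "M = scale_measure (ennreal a) (distr (density lborel (indicator (polar_box a b))) borel polar_map)"
  define N where "N = density lborel (indicator (annulus a b) :: real^2 \<Rightarrow> ennreal)"
  have sets: "sets M = sets N" by (simp add: M_def N_def)
  have "emeasure M B \<le> emeasure N B" for B
  proof (cases "B \<in> sets borel")
    case True
    have pre: "polar_map -` B \<in> sets borel"
      using measurable_sets[OF polar_map_measurable True] by simp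
    have "emeasure M B = ennreal a * emeasure lborel (polar_box a b \<inter> polar_map -` B)"
      using True pre by (simp add: M_def emeasure_distr emeasure_restricted)
    also have "\<dots> \<le> emeasure lborel (B \<inter> annulus a b)"
      using emeasure_polar_map_vimage_le[OF a True] by (subst Int_commute)
    also have "\<dots> = emeasure N B"
      using True by (subst Int_commute) (simp add: N_def emeasure_restricted)
    finally show ?thesis .
  next
    case False
    then show ?thesis by (simp add: M_def emeasure_notin_sets)
  qed
  \<comment> \<open>The order on measures compares spaces and \<sigma>-algebras first; these
    coincide, so the setwise comparison decides.\<close>
  then have "M \<le> N"
    unfolding le_measure_iff le_fun_def by (simp only: sets sets_eq_imp_space_eq[OF sets] if_True) simp
  have "(\<integral>\<^sup>+\<theta>. \<integral>\<^sup>+r. f (r *\<^sub>R e_r \<theta>) * indicator {a<..<b} r * indicator {0<..<2*pi} \<theta> \<partial>lborel \<partial>lborel)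
      = (\<integral>\<^sup>+\<theta>. \<integral>\<^sup>+r. (\<lambda>p. f (polar_map (vector [fst p, snd p])) * indicator (polar_box a b) (vector [fst p, snd p])) (r, \<theta>) \<partial>lborel \<partial>lborel)"
    by (intro nn_integral_cong) (auto simp: polar_map_def polar_box_def indicator_def)
  also have "\<dots> = (\<integral>\<^sup>+p. f (polar_map (vector [fst p, snd p])) * indicator (polar_box a b) (vector [fst p, snd p]) \<partial>(lborel \<Otimes>\<^sub>M lborel))"
    unfolding vector_2_axis by (intro lborel_pair.nn_integral_snd) measurable
  also have "\<dots> = (\<integral>\<^sup>+y. f (polar_map y) * indicator (polar_box a b) y \<partial>lborel)"
    unfolding lborel_vec2_eq_distr unfolding vector_2_axis by (subst nn_integral_distr) measurable
  finally have "ennreal a * (\<integral>\<^sup>+\<theta>. \<integral>\<^sup>+r. f (r *\<^sub>R e_r \<theta>) * indicator {a<..<b} r * indicator {0<..<2*pi} \<theta> \<partial>lborel \<partial>lborel)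
      = nn_integral M f"
    by (simp add: M_def nn_integral_scale_measure nn_integral_distr nn_integral_density mult.commute)
  also have "\<dots> \<le> nn_integral N f"
    by (rule nn_integral_mono_measure[OF sets \<open>M \<le> N\<close>])
  also have "\<dots> = (\<integral>\<^sup>+x\<in>annulus a b. f x \<partial>lborel)"
    by (simp add: N_def nn_integral_density mult.commute)
  finally show ?thesis .
qed

text \<open>The indicator of the exceptional set integrates to \<open>0\<close> over the annulus, so
  by \<open>nn_integral_polar_le\<close> almost every ray meets this set in a null set.\<close>

lemma AE_annulus_imp_AE_rays:
  assumes a: "0 < a" and AE: "AE x in lebesgue_on (annulus a b). P x"
  shows "AE \<theta> in lborel. \<theta> \<in> {0<..<2*pi} \<longrightarrow> (AE r in lborel. r \<in> {a<..<b} \<longrightarrow> P (r *\<^sub>R e_r \<theta>))"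
proof -
  have "AE x in lborel. x \<in> annulus a b \<longrightarrow> P x"
    using AE by (simp add: AE_restrict_space_iff AE_completion_iff)
  \<comment> \<open>\<open>P\<close> need not be measurable, so its exceptional set is enclosed in a
    Borel null set.\<close>
  then obtain N where N: "{x. \<not> (x \<in> annulus a b \<longrightarrow> P x)} \<subseteq> N" "N \<in> null_sets lborel"
    by (auto elim!: AE_E simp: null_sets_def)
  then have [measurable]: "N \<in> sets borel" by auto
  have [measurable]: "(\<lambda>p. snd p *\<^sub>R e_r (fst p)) \<in> borel_measurable (borel \<Otimes>\<^sub>M borel)"
    unfolding e_r_def vector_2_axis by measurable
  have "ennreal a * (\<integral>\<^sup>+\<theta>. \<integral>\<^sup>+r. indicator N (r *\<^sub>R e_r \<theta>) * indicator {a<..<b} r * indicator {0<..<2*pi} \<theta> \<partial>lborel \<partial>lborel)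
      \<le> (\<integral>\<^sup>+x\<in>annulus a b. indicator N x \<partial>lborel)"
    by (rule nn_integral_polar_le[OF a]) measurable
  also have "\<dots> \<le> (\<integral>\<^sup>+x. indicator N x \<partial>lborel)"
    by (intro nn_integral_mono) (auto simp: indicator_def)
  also have "\<dots> = 0" using N(2) by (simp add: null_sets_def)
  finally have "(\<integral>\<^sup>+\<theta>. \<integral>\<^sup>+r. indicator N (r *\<^sub>R e_r \<theta>) * indicator {a<..<b} r * indicator {0<..<2*pi} \<theta> \<partial>lborel \<partial>lborel) = 0"
    using a by simp
  then have "AE \<theta> in lborel. (\<integral>\<^sup>+r. indicator N (r *\<^sub>R e_r \<theta>) * indicator {a<..<b} r * indicator {0<..<2*pi} \<theta> \<partial>lborel) = 0"
    by (subst (asm) nn_integral_0_iff_AE) measurable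
  then show ?thesis
  proof eventually_elim
    case (elim \<theta>)
    show ?case
    proof
      assume \<theta>: "\<theta> \<in> {0<..<2*pi}"
      have "AE r in lborel. indicator N (r *\<^sub>R e_r \<theta>) * indicator {a<..<b} r * indicator {0<..<2*pi} \<theta> = (0::ennreal)"
        using elim by (subst (asm) nn_integral_0_iff_AE) measurable
      then show "AE r in lborel. r \<in> {a<..<b} \<longrightarrow> P (r *\<^sub>R e_r \<theta>)"
      proof eventually_elim
        case (elim r)
        show ?case
        proof
          assume r: "r \<in> {a<..<b}"
          then have "r *\<^sub>R e_r \<theta> \<notin> N" using elim \<theta> by (simp add: indicator_def split: if_splits)
          moreover have "r *\<^sub>R e_r \<theta> \<in> annulus a b" using r a by (simp add: annulus_def)
          ultimately show "P (r *\<^sub>R e_r \<theta>)" using N(1) by blast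
        qed
      qed
    qed
  qed
qed

lemma e_r_measurable [measurable]: "e_r \<in> borel_measurable borel"
  unfolding e_r_def[abs_def] vector_2_axis by measurable


section \<open>The trace on the boundary circles\<close>

lemma C1_map_continuous_on: "C1_map v \<Longrightarrow> continuous_on S v"
  by (auto simp: C1_map_def intro!: continuous_at_imp_continuous_on differentiable_imp_continuous_within)

lemma continuous_on_matrix_frechet_derivative:
  fixes v :: "real^2 \<Rightarrow> real^2"
  assumes "C1_map v"
  shows "continuous_on S (\<lambda>x. matrix (frechet_derivative v (at x)))"
proof -
  have "continuous_on S (\<lambda>x. frechet_derivative v (at x) (axis j 1))" for j
    using assms by (auto simp: C1_map_def intro: continuous_on_subset)
  then show ?thesis
    unfolding matrix_def by (intro continuous_on_vec_lambda continuous_on_component)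
qed

text \<open>The matrix norm is the Frobenius norm; Cauchy-Schwarz applies to each row.\<close>

lemma norm_matrix_vector_mult_le:
  fixes A :: "real^'n^'m"
  shows "norm (A *v x) \<le> norm A * norm x"
proof -
  have "norm (A *v x) \<le> L2_set (\<lambda>i. norm (A $ i) * norm x) UNIV"
    unfolding norm_vec_def[of "A *v x"]
    by (intro L2_set_mono) (simp_all add: matrix_vector_mul_component Cauchy_Schwarz_ineq2)
  also have "\<dots> = norm A * norm x"
    by (simp add: norm_vec_def[of A] L2_set_left_distrib)
  finally show ?thesis .
qed

text \<open>AM-GM with the free parameter \<open>k\<close> replaces the Cauchy-Schwarz inequality along the ray.\<close>

lemma norm_radial_increment_le:
  fixes v :: "real^2 \<Rightarrow> real^2"
  defines "g \<equiv> \<lambda>x. norm (matrix (frechet_derivative v (at x)))"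
  assumes v: "C1_map v" and rR: "r \<in> {\<alpha>..\<beta>}" "R \<in> {\<alpha>..\<beta>}" and k: "k > 0"
  shows "norm (v (r *\<^sub>R e_r \<theta>) - v (R *\<^sub>R e_r \<theta>))
    \<le> k * (\<beta> - \<alpha>) + integral {\<alpha>..\<beta>} (\<lambda>t. (g (t *\<^sub>R e_r \<theta>))\<^sup>2) / (4 * k)"
proof -
  \<comment> \<open>\<open>G\<close> dominates \<open>g\<close> along the ray because
    \<open>(2 * k - g)^2 \<ge> 0\<close>, and its integral is affine in that of
    \<open>g^2\<close>.\<close>
  define G where "G = (\<lambda>t. k + (g (t *\<^sub>R e_r \<theta>))\<^sup>2 / (4 * k))"
  have g_cont: "continuous_on S (\<lambda>t. g (t *\<^sub>R e_r \<theta>))" for S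
    unfolding g_def
    by (intro continuous_on_norm continuous_on_compose2[OF continuous_on_matrix_frechet_derivative[OF v, of UNIV]] continuous_intros) auto
  then have G_cont: "continuous_on S G" for S
    unfolding G_def using k by (intro continuous_intros) auto
  have G_nonneg: "0 \<le> G t" for t using k by (simp add: G_def)
  have deriv: "((\<lambda>t. v (t *\<^sub>R e_r \<theta>)) has_vector_derivative frechet_derivative v (at (t *\<^sub>R e_r \<theta>)) (e_r \<theta>)) (at t within S)" for t S
  proof -
    have "(v has_derivative frechet_derivative v (at (t *\<^sub>R e_r \<theta>))) (at (t *\<^sub>R e_r \<theta>))"
      using v by (simp add: C1_map_def frechet_derivative_works[symmetric])
    moreover have "((\<lambda>t. t *\<^sub>R e_r \<theta>) has_vector_derivative e_r \<theta>) (at t within S)"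
      by (auto intro!: derivative_eq_intros simp: has_vector_derivative_def)
    ultimately show ?thesis
      using vector_derivative_diff_chain_within[of "\<lambda>t. t *\<^sub>R e_r \<theta>" "e_r \<theta>" t S v]
      by (auto simp: o_def intro: has_derivative_at_withinI)
  qed
  have bound: "norm (frechet_derivative v (at (t *\<^sub>R e_r \<theta>)) (e_r \<theta>)) \<le> G t" for t
  proof -
    have lin: "linear (frechet_derivative v (at (t *\<^sub>R e_r \<theta>)))"
      using v by (auto simp: C1_map_def intro: linear_frechet_derivative)
    have "norm (frechet_derivative v (at (t *\<^sub>R e_r \<theta>)) (e_r \<theta>))
        = norm (matrix (frechet_derivative v (at (t *\<^sub>R e_r \<theta>))) *v e_r \<theta>)"
      using fun_cong[OF matrix_vector_mul(2)[OF lin], of "e_r \<theta>"] by simp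
    also have "\<dots> \<le> g (t *\<^sub>R e_r \<theta>)"
      unfolding g_def using norm_matrix_vector_mult_le[of _ "e_r \<theta>"] by simp
    also have "\<dots> \<le> G t"
    proof -
      have "0 \<le> (2 * k - g (t *\<^sub>R e_r \<theta>))\<^sup>2" by simp
      then show ?thesis using k by (simp add: G_def field_simps power2_eq_square)
    qed
    finally show ?thesis .
  qed
  \<comment> \<open>Since \<open>G \<ge> 0\<close>, the interval of integration may be enlarged to
    \<open>{\<alpha>..\<beta>}\<close>, so the bound is the same for all \<open>x\<close> and
    \<open>y\<close>.\<close>
  have ordered: "norm (v (y *\<^sub>R e_r \<theta>) - v (x *\<^sub>R e_r \<theta>)) \<le> integral {\<alpha>..\<beta>} G"
    if "\<alpha> \<le> x" "x \<le> y" "y \<le> \<beta>" for x y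
  proof -
    have FTC: "((\<lambda>t. frechet_derivative v (at (t *\<^sub>R e_r \<theta>)) (e_r \<theta>)) has_integral
        (v (y *\<^sub>R e_r \<theta>) - v (x *\<^sub>R e_r \<theta>))) {x..y}"
      by (rule fundamental_theorem_of_calculus[OF \<open>x \<le> y\<close> deriv])
    have "norm (v (y *\<^sub>R e_r \<theta>) - v (x *\<^sub>R e_r \<theta>)) \<le> integral {x..y} G"
      using integral_norm_bound_integral[OF has_integral_integrable[OF FTC] integrable_continuous_real[OF G_cont] bound]
        integral_unique[OF FTC] by simp
    also have "\<dots> \<le> integral {\<alpha>..\<beta>} G"
      using that by (intro integral_subset_le integrable_continuous_real G_cont) (auto intro: G_nonneg)
    finally show ?thesis .
  qed
  have "norm (v (r *\<^sub>R e_r \<theta>) - v (R *\<^sub>R e_r \<theta>)) \<le> integral {\<alpha>..\<beta>} G"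
    using ordered[of r R] ordered[of R r] rR by (cases "r \<le> R") (auto simp: norm_minus_commute)
  also have "\<dots> = k * (\<beta> - \<alpha>) + integral {\<alpha>..\<beta>} (\<lambda>t. (g (t *\<^sub>R e_r \<theta>))\<^sup>2) / (4 * k)"
    unfolding G_def using rR k
    by (subst integral_add) (auto intro!: integrable_continuous_real continuous_intros g_cont)
  finally show ?thesis .
qed

text \<open>
  With \<open>L = \<beta> - \<alpha>\<close>, the left-hand side is of order \<open>L\<close>. For the maps \<open>v = v\<^sub>n\<close> approximating \<open>u\<close> the first
  and third terms on the right tend to \<open>0\<close>, while the second one is of order \<open>L\<^sup>2\<close>: a contradiction for
  small \<open>L\<close>, so \<open>\<rho>\<close> cannot stay away from \<open>R\<close> near \<open>R\<close>.
\<close>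

lemma nn_integral_trace_bound:
  fixes v :: "real^2 \<Rightarrow> real^2" and \<rho> :: "real \<Rightarrow> real"
  assumes v: "C1_map v" and \<alpha>: "0 < \<alpha>" "\<alpha> < \<beta>" and R: "R \<in> {\<alpha>..\<beta>}" and \<mu>: "\<mu> > 0"
    and \<rho>: "continuous_on {\<alpha><..<\<beta>} \<rho>" and far: "\<And>r. r \<in> {\<alpha><..<\<beta>} \<Longrightarrow> 4 * \<mu> \<le> \<bar>\<rho> r - R\<bar>"
  shows "ennreal (8 * pi * \<mu>\<^sup>2 * (\<beta> - \<alpha>) * \<alpha>)
    \<le> (\<integral>\<^sup>+x\<in>annulus \<alpha> \<beta>. ennreal ((\<rho> (norm x) - norm (v x))\<^sup>2) \<partial>lborel)
      + ennreal ((\<beta> - \<alpha>)\<^sup>2) *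
          (\<integral>\<^sup>+x\<in>annulus \<alpha> \<beta>. ennreal ((norm (matrix (frechet_derivative v (at x))))\<^sup>2) \<partial>lborel)
      + ennreal (\<alpha> * (\<beta> - \<alpha>)) *
          (\<integral>\<^sup>+\<theta>\<in>{0<..<2*pi}. ennreal ((norm (v (R *\<^sub>R e_r \<theta>) - R *\<^sub>R e_r \<theta>))\<^sup>2) \<partial>lborel)"
proof -
  define L where "L = \<beta> - \<alpha>"
  define g where "g = (\<lambda>x. norm (matrix (frechet_derivative v (at x))))"
  \<comment> \<open>The indicator makes \<open>f1\<close> Borel on the whole plane,
    \<open>\<rho>\<close> being continuous only on the open interval.\<close>
  define f1 where "f1 = (\<lambda>x. ennreal (indicator (annulus \<alpha> \<beta>) x *\<^sub>R (\<rho> (norm x) - norm (v x))\<^sup>2))"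
  define f2 where "f2 = (\<lambda>x. ennreal ((g x)\<^sup>2))"
  define Y where "Y = (\<lambda>\<theta>. \<integral>\<^sup>+t. f2 (t *\<^sub>R e_r \<theta>) * indicator {\<alpha><..<\<beta>} t \<partial>lborel)"
  define Z where "Z = (\<lambda>\<theta>. ennreal ((norm (v (R *\<^sub>R e_r \<theta>) - R *\<^sub>R e_r \<theta>))\<^sup>2))"
  have L: "L > 0" using \<alpha> by (simp add: L_def)
  have g_cont: "continuous_on UNIV g"
    unfolding g_def by (intro continuous_on_norm continuous_on_matrix_frechet_derivative v)
  have [measurable]: "g \<in> borel_measurable borel" "v \<in> borel_measurable borel"
    using g_cont C1_map_continuous_on[OF v] by (auto intro: borel_measurable_continuous_onI)
  have "continuous_on (annulus \<alpha> \<beta>) (\<lambda>x. (\<rho> (norm x) - norm (v x))\<^sup>2)"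
    by (intro continuous_intros continuous_on_compose2[OF \<rho>] C1_map_continuous_on v) (auto simp: annulus_def)
  then have [measurable]: "f1 \<in> borel_measurable borel"
    unfolding f1_def by (intro measurable_compose[OF _ measurable_ennreal] borel_measurable_continuous_on_indicator) auto
  have [measurable]: "f2 \<in> borel_measurable borel" unfolding f2_def by measurable
  have [measurable]: "Y \<in> borel_measurable borel" unfolding Y_def by measurable
  have [measurable]: "Z \<in> borel_measurable borel" unfolding Z_def by measurable
  have pointwise: "ennreal (4 * \<mu>\<^sup>2) \<le> f1 (r *\<^sub>R e_r \<theta>) + ennreal L * Y \<theta> + Z \<theta>" if r: "r \<in> {\<alpha><..<\<beta>}" for r \<theta>
  proof -
    define X' Y' Z' where "X' = \<bar>\<rho> r - norm (v (r *\<^sub>R e_r \<theta>))\<bar>"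
      and "Y' = integral {\<alpha>..\<beta>} (\<lambda>t. (g (t *\<^sub>R e_r \<theta>))\<^sup>2)"
      and "Z' = norm (v (R *\<^sub>R e_r \<theta>) - R *\<^sub>R e_r \<theta>)"
    have cont: "continuous_on S (\<lambda>t. (g (t *\<^sub>R e_r \<theta>))\<^sup>2)" for S
      by (intro continuous_intros continuous_on_compose2[OF g_cont]) auto
    \<comment> \<open>The choice \<open>k = \<mu> / L\<close> turns the constant term
      \<open>k * (\<beta> - \<alpha>)\<close> into \<open>\<mu>\<close>.\<close>
    have "norm (v (r *\<^sub>R e_r \<theta>) - v (R *\<^sub>R e_r \<theta>)) \<le> \<mu> / L * (\<beta> - \<alpha>) + Y' / (4 * (\<mu> / L))"
      using norm_radial_increment_le[OF v, of r \<alpha> \<beta> R "\<mu> / L" \<theta>] r R \<mu> L by (simp add: Y'_def g_def)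
    then have inc: "norm (v (r *\<^sub>R e_r \<theta>) - v (R *\<^sub>R e_r \<theta>)) \<le> \<mu> + L * Y' / (4 * \<mu>)"
      using L by (simp add: L_def[symmetric] mult.commute)
    have "norm (R *\<^sub>R e_r \<theta>) = R" using R \<alpha> by simp
    then have "\<bar>\<rho> r - R\<bar> \<le> X' + norm (v (r *\<^sub>R e_r \<theta>) - v (R *\<^sub>R e_r \<theta>)) + Z'"
      using norm_triangle_ineq3[of "v (r *\<^sub>R e_r \<theta>)" "v (R *\<^sub>R e_r \<theta>)"]
        norm_triangle_ineq3[of "v (R *\<^sub>R e_r \<theta>)" "R *\<^sub>R e_r \<theta>"]
      unfolding X'_def Z'_def by linarith
    then have "4 * \<mu> \<le> X' + (\<mu> + L * Y' / (4 * \<mu>)) + Z'"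
      using inc far[OF r] by linarith
    \<comment> \<open>Applied to \<open>X'\<close> and \<open>Z'\<close>, this costs
      \<open>2 * \<mu>\<close>; the increment has already cost \<open>\<mu>\<close>. Of the
      \<open>4 * \<mu>\<close> on the left, one \<open>\<mu>\<close> remains.\<close>
    moreover have "t \<le> \<mu> + t\<^sup>2 / (4 * \<mu>)" for t
    proof -
      have "0 \<le> (2 * \<mu> - t)\<^sup>2" by simp
      then show ?thesis using \<mu> by (simp add: field_simps power2_eq_square)
    qed
    ultimately have "\<mu> \<le> X'\<^sup>2 / (4 * \<mu>) + L * Y' / (4 * \<mu>) + Z'\<^sup>2 / (4 * \<mu>)"
      by (smt (verit))
    then have real_ineq: "4 * \<mu>\<^sup>2 \<le> X'\<^sup>2 + L * Y' + Z'\<^sup>2"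
      using \<mu> by (simp add: field_simps power2_eq_square)
    \<comment> \<open>The gauge integral over the closed interval equals the Lebesgue integral over
      the open one, the endpoints being null.\<close>
    have Y: "ennreal Y' = Y \<theta>"
    proof -
      have "ennreal Y' = (\<integral>\<^sup>+t. ennreal (indicator {\<alpha>..\<beta>} t * (g (t *\<^sub>R e_r \<theta>))\<^sup>2) \<partial>lborel)"
      proof (rule nn_integral_has_integral_lborel[symmetric])
        have "((\<lambda>t. (g (t *\<^sub>R e_r \<theta>))\<^sup>2) has_integral Y') {\<alpha>..\<beta>}"
          unfolding Y'_def by (intro integrable_integral integrable_continuous_real cont)
        then have "((\<lambda>t. if t \<in> {\<alpha>..\<beta>} then (g (t *\<^sub>R e_r \<theta>))\<^sup>2 else 0) has_integral Y') UNIV"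
          by (simp only: has_integral_restrict_UNIV)
        moreover have "(\<lambda>t. if t \<in> {\<alpha>..\<beta>} then (g (t *\<^sub>R e_r \<theta>))\<^sup>2 else 0)
            = (\<lambda>t. indicator {\<alpha>..\<beta>} t * (g (t *\<^sub>R e_r \<theta>))\<^sup>2)"
          by (auto simp: indicator_def)
        ultimately show "((\<lambda>t. indicator {\<alpha>..\<beta>} t * (g (t *\<^sub>R e_r \<theta>))\<^sup>2) has_integral Y') UNIV" by simp
      qed auto
      also have "\<dots> = Y \<theta>"
        unfolding Y_def
      proof (rule nn_integral_cong_AE)
        have "AE t in lborel. t \<noteq> \<alpha> \<and> t \<noteq> \<beta>"
          using AE_lborel_singleton[of \<alpha>] AE_lborel_singleton[of \<beta>] by auto
        then show "AE t in lborel. ennreal (indicator {\<alpha>..\<beta>} t * (g (t *\<^sub>R e_r \<theta>))\<^sup>2)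
            = f2 (t *\<^sub>R e_r \<theta>) * indicator {\<alpha><..<\<beta>} t"
          by eventually_elim (auto simp: f2_def indicator_def)
      qed
      finally show ?thesis .
    qed
    have "Y' \<ge> 0" unfolding Y'_def by (intro integral_nonneg integrable_continuous_real cont) simp
    have "r *\<^sub>R e_r \<theta> \<in> annulus \<alpha> \<beta>" using r \<alpha> by (simp add: annulus_def)
    then have X: "f1 (r *\<^sub>R e_r \<theta>) = ennreal (X'\<^sup>2)" using r \<alpha> by (simp add: f1_def X'_def)
    show ?thesis
      using real_ineq L \<open>Y' \<ge> 0\<close> unfolding X Y[symmetric] Z_def Z'_def[symmetric]
      by (simp add: ennreal_leI flip: ennreal_mult ennreal_plus)
  qed
  let ?S = "indicator {\<alpha><..<\<beta>} :: real \<Rightarrow> ennreal" and ?T = "indicator {0<..<2*pi} :: real \<Rightarrow> ennreal"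
  define I where "I = (\<lambda>f. \<integral>\<^sup>+\<theta>. \<integral>\<^sup>+r. f (r *\<^sub>R e_r \<theta>) * ?S r * ?T \<theta> \<partial>lborel \<partial>lborel)"
  have S: "(\<integral>\<^sup>+r. ?S r \<partial>lborel) = ennreal L" using \<alpha> by (simp add: L_def)
  have T: "(\<integral>\<^sup>+\<theta>. ?T \<theta> \<partial>lborel) = ennreal (2 * pi)" by simp
  \<comment> \<open>The pointwise bound is integrated over radius and angle. \<open>Y\<close> and
    \<open>Z\<close> do not depend on \<open>r\<close> and gain a factor \<open>L\<close>, which
    makes the coefficient of the gradient term \<open>L^2\<close>.\<close>
  have "ennreal (4 * \<mu>\<^sup>2) * ennreal L * ennreal (2 * pi)
      = (\<integral>\<^sup>+\<theta>. \<integral>\<^sup>+r. ennreal (4 * \<mu>\<^sup>2) * ?S r * ?T \<theta> \<partial>lborel \<partial>lborel)"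
    by (simp add: nn_integral_multc nn_integral_cmult S T del: nn_integral_indicator)
  also have "\<dots> \<le> (\<integral>\<^sup>+\<theta>. \<integral>\<^sup>+r. (f1 (r *\<^sub>R e_r \<theta>) + ennreal L * Y \<theta> + Z \<theta>) * ?S r * ?T \<theta> \<partial>lborel \<partial>lborel)"
    by (intro nn_integral_mono) (auto simp: indicator_def pointwise)
  also have "\<dots> = (\<integral>\<^sup>+\<theta>. (\<integral>\<^sup>+r. f1 (r *\<^sub>R e_r \<theta>) * ?S r * ?T \<theta> \<partial>lborel)
      + ennreal L * ennreal L * (Y \<theta> * ?T \<theta>) + ennreal L * (Z \<theta> * ?T \<theta>) \<partial>lborel)"
  proof (rule nn_integral_cong)
    fix \<theta>
    have "(\<integral>\<^sup>+r. (f1 (r *\<^sub>R e_r \<theta>) + ennreal L * Y \<theta> + Z \<theta>) * ?S r * ?T \<theta> \<partial>lborel)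
        = (\<integral>\<^sup>+r. f1 (r *\<^sub>R e_r \<theta>) * ?S r * ?T \<theta> + (ennreal L * Y \<theta> * ?T \<theta>) * ?S r + (Z \<theta> * ?T \<theta>) * ?S r \<partial>lborel)"
      by (intro nn_integral_cong) (simp add: distrib_left distrib_right mult_ac)
    also have "\<dots> = (\<integral>\<^sup>+r. f1 (r *\<^sub>R e_r \<theta>) * ?S r * ?T \<theta> \<partial>lborel)
        + (ennreal L * Y \<theta> * ?T \<theta>) * ennreal L + (Z \<theta> * ?T \<theta>) * ennreal L"
      by (simp add: nn_integral_add nn_integral_cmult S del: nn_integral_indicator)
    finally show "(\<integral>\<^sup>+r. (f1 (r *\<^sub>R e_r \<theta>) + ennreal L * Y \<theta> + Z \<theta>) * ?S r * ?T \<theta> \<partial>lborel)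
        = (\<integral>\<^sup>+r. f1 (r *\<^sub>R e_r \<theta>) * ?S r * ?T \<theta> \<partial>lborel)
          + ennreal L * ennreal L * (Y \<theta> * ?T \<theta>) + ennreal L * (Z \<theta> * ?T \<theta>)"
      by (simp add: mult_ac)
  qed
  also have "\<dots> = I f1 + ennreal L * ennreal L * (\<integral>\<^sup>+\<theta>. Y \<theta> * ?T \<theta> \<partial>lborel) + ennreal L * (\<integral>\<^sup>+\<theta>. Z \<theta> * ?T \<theta> \<partial>lborel)"
    by (simp add: nn_integral_add nn_integral_cmult I_def)
  also have "(\<integral>\<^sup>+\<theta>. Y \<theta> * ?T \<theta> \<partial>lborel) = I f2"
    by (simp add: I_def Y_def nn_integral_multc)
  finally have main: "ennreal (4 * \<mu>\<^sup>2) * ennreal L * ennreal (2 * pi)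
      \<le> I f1 + ennreal L * ennreal L * I f2 + ennreal L * (\<integral>\<^sup>+\<theta>. Z \<theta> * ?T \<theta> \<partial>lborel)" .
  \<comment> \<open>The factor \<open>\<alpha>\<close> lets \<open>nn_integral_polar_le\<close>
    replace \<open>I f1\<close> and \<open>I f2\<close> by area integrals.\<close>
  have "ennreal (8 * pi * \<mu>\<^sup>2 * (\<beta> - \<alpha>) * \<alpha>) = ennreal \<alpha> * (ennreal (4 * \<mu>\<^sup>2) * ennreal L * ennreal (2 * pi))"
    using \<alpha> L by (simp add: L_def mult_ac flip: ennreal_mult)
  also have "\<dots> \<le> ennreal \<alpha> * (I f1 + ennreal L * ennreal L * I f2 + ennreal L * (\<integral>\<^sup>+\<theta>. Z \<theta> * ?T \<theta> \<partial>lborel))"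
    by (rule mult_left_mono[OF main]) simp
  also have "\<dots> = ennreal \<alpha> * I f1 + ennreal (L\<^sup>2) * (ennreal \<alpha> * I f2) + ennreal (\<alpha> * L) * (\<integral>\<^sup>+\<theta>. Z \<theta> * ?T \<theta> \<partial>lborel)"
    using \<alpha> L by (simp add: distrib_left power2_eq_square ennreal_mult mult_ac)
  also have "\<dots> \<le> (\<integral>\<^sup>+x\<in>annulus \<alpha> \<beta>. f1 x \<partial>lborel) + ennreal (L\<^sup>2) * (\<integral>\<^sup>+x\<in>annulus \<alpha> \<beta>. f2 x \<partial>lborel)
      + ennreal (\<alpha> * L) * (\<integral>\<^sup>+\<theta>. Z \<theta> * ?T \<theta> \<partial>lborel)"
    unfolding I_def by (intro add_mono mult_left_mono nn_integral_polar_le \<alpha>) auto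
  also have "(\<integral>\<^sup>+x\<in>annulus \<alpha> \<beta>. f1 x \<partial>lborel)
      = (\<integral>\<^sup>+x\<in>annulus \<alpha> \<beta>. ennreal ((\<rho> (norm x) - norm (v x))\<^sup>2) \<partial>lborel)"
    by (intro nn_integral_cong) (auto simp: f1_def indicator_def)
  finally show ?thesis by (simp add: f2_def g_def Z_def L_def)
qed


lemma set_nn_integral_lborel_eq_lebesgue_on:
  assumes "S \<in> sets borel"
  shows "(\<integral>\<^sup>+x\<in>S. f x \<partial>lborel) = (\<integral>\<^sup>+x. f x \<partial>lebesgue_on S)"
  using assms by (simp add: nn_integral_restrict_space nn_integral_completion)

text \<open>Otherwise \<open>\<rho>\<close> stays away from \<open>R\<close> on a shell of width
  \<open>L\<close> next to the circle. The trace bound for the approximating maps gives in the limit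
  \<open>8 * pi * \<mu>^2 * L * \<alpha> \<le> 2 * L^2 * K\<close>, which fails for small
  \<open>L\<close>.\<close>

lemma has_trace_imp_modulus_boundary:
  fixes u :: "real^2 \<Rightarrow> real^2"
  assumes ab: "0 < a" "a < b" and u: "u \<in> W12 (annulus a b)" and tr: "has_trace a b u (\<lambda>x. x)"
    and mod: "AE x in lebesgue_on (annulus a b). norm (u x) = \<rho> (norm x)"
    and cont: "continuous_on {a..b} \<rho>" and R: "R \<in> {a, b}"
  shows "\<rho> R = R"
proof (rule ccontr)
  assume "\<rho> R \<noteq> R"
  \<comment> \<open>The gap at \<open>R\<close> is \<open>8 * \<mu>\<close>; continuity may use up
    \<open>3 * \<mu>\<close>, which leaves more than the required \<open>4 * \<mu>\<close>.\<close>
  define \<mu> where "\<mu> = \<bar>\<rho> R - R\<bar> / 8"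
  have \<mu>: "\<mu> > 0" using \<open>\<rho> R \<noteq> R\<close> by (simp add: \<mu>_def)
  define A where "A = annulus a b"
  define G where "G = wgrad A u"
  \<comment> \<open>\<open>wgrad\<close> is a Hilbert choice, meaningful because \<open>u\<close>
    has some weak gradient.\<close>
  obtain G' where "has_weak_gradient A u G'"
    using u by (auto simp: W12_def A_def)
  then have G: "has_weak_gradient A u G"
    unfolding G_def wgrad_def by (rule someI[of "has_weak_gradient A u"])
  have A: "A \<in> sets borel" by (simp add: A_def)
  have [measurable]: "u \<in> borel_measurable (lebesgue_on A)" "G \<in> borel_measurable (lebesgue_on A)"
    using G by (auto simp: has_weak_gradient_def square_integrable_def)
  define K where "K = (LINT x|lebesgue_on A. (norm (G x))\<^sup>2)"
  have K: "(\<integral>\<^sup>+x. ennreal ((norm (G x))\<^sup>2) \<partial>lebesgue_on A) = ennreal K" "K \<ge> 0"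
    using G unfolding K_def by (auto simp: has_weak_gradient_def square_integrable_def intro: nn_integral_eq_integral)
  obtain v where v: "\<And>n. C1_map (v n)" and
    D: "(\<lambda>n. \<integral>\<^sup>+x. ennreal ((norm (v n x - u x))\<^sup>2 +
               (norm (matrix (frechet_derivative (v n) (at x)) - G x))\<^sup>2) \<partial>lebesgue_on A) \<longlonglongrightarrow> 0" and
    T: "(\<lambda>n. \<integral>\<^sup>+\<theta>. ennreal ((norm (v n (R *\<^sub>R e_r \<theta>) - R *\<^sub>R e_r \<theta>))\<^sup>2) \<partial>lebesgue_on {0..2*pi}) \<longlonglongrightarrow> 0"
    using tr R unfolding has_trace_def A_def G_def by blast
  obtain \<delta> where \<delta>: "\<delta> > 0" "\<And>r. \<lbrakk>r \<in> {a..b}; \<bar>r - R\<bar> < \<delta>\<rbrakk> \<Longrightarrow> \<bar>\<rho> r - \<rho> R\<bar> < 3 * \<mu>"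
  proof -
    have "R \<in> {a..b}" using R ab by auto
    then show thesis
      using cont \<mu> that unfolding continuous_on_iff dist_real_def
      by (metis mult_pos_pos zero_less_numeral)
  qed
  have "8 * pi * \<mu>\<^sup>2 * a > 0" using \<mu> ab by simp
  \<comment> \<open>The last condition, multiplied by \<open>L\<close>, will contradict the limit
    inequality. The denominator \<open>2 * K + 1\<close> used below is positive even when
    \<open>K = 0\<close>.\<close>
  then obtain L where L: "0 < L" "L < \<delta>" "L < b - a" "2 * L * K < 8 * pi * \<mu>\<^sup>2 * a"
  proof -
    have "8 * pi * \<mu>\<^sup>2 * a / (2 * K + 1) > 0" using K(2) \<mu> ab by simp
    then obtain L where L: "0 < L" "L < min \<delta> (min (b - a) (8 * pi * \<mu>\<^sup>2 * a / (2 * K + 1)))"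
      using dense[of 0 "min \<delta> (min (b - a) (8 * pi * \<mu>\<^sup>2 * a / (2 * K + 1)))"] \<delta>(1) ab by auto
    then have "L * (2 * K + 1) < 8 * pi * \<mu>\<^sup>2 * a"
      using K(2) pos_less_divide_eq[of "2 * K + 1" L "8 * pi * \<mu>\<^sup>2 * a"] by simp
    then show thesis using that[of L] L by (simp add: algebra_simps)
  qed
  \<comment> \<open>The shell lies inside the annulus and has \<open>R\<close> as one of its two
    radii.\<close>
  define \<alpha> where "\<alpha> = (if R = a then a else b - L)"
  define \<beta> where "\<beta> = \<alpha> + L"
  have \<alpha>: "a \<le> \<alpha>" "\<alpha> < \<beta>" "\<beta> \<le> b" "R \<in> {\<alpha>..\<beta>}" "\<beta> - \<alpha> = L"
    using R L ab by (auto simp: \<alpha>_def \<beta>_def)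
  have far: "4 * \<mu> \<le> \<bar>\<rho> r - R\<bar>" if "r \<in> {\<alpha><..<\<beta>}" for r
  proof -
    have "\<bar>r - R\<bar> < \<delta>" using that \<alpha>(4,5) L(2) by auto
    then have "\<bar>\<rho> r - \<rho> R\<bar> < 3 * \<mu>" using \<delta>(2)[of r] that \<alpha> by auto
    moreover have "\<bar>\<rho> R - R\<bar> = 8 * \<mu>" by (simp add: \<mu>_def)
    ultimately show ?thesis using \<mu> by linarith
  qed
  have sub: "annulus \<alpha> \<beta> \<subseteq> A" using \<alpha> by (auto simp: annulus_def A_def)
  \<comment> \<open>Once both approximation errors are at most \<open>\<epsilon>\<close>, the three
    terms of the trace bound are at most \<open>\<epsilon>\<close>,
    \<open>L^2 * (2 * \<epsilon> + 2 * K)\<close> and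
    \<open>\<alpha> * L * \<epsilon>\<close>.\<close>
  have approx: "8 * pi * \<mu>\<^sup>2 * L * \<alpha> \<le> 2 * L\<^sup>2 * K + \<epsilon> * (1 + 2 * L\<^sup>2 + \<alpha> * L)" if \<epsilon>: "\<epsilon> > 0" for \<epsilon> :: real
  proof -
    have "\<forall>\<^sub>F n in sequentially. (\<integral>\<^sup>+x. ennreal ((norm (v n x - u x))\<^sup>2 +
               (norm (matrix (frechet_derivative (v n) (at x)) - G x))\<^sup>2) \<partial>lebesgue_on A) < ennreal \<epsilon> \<and>
        (\<integral>\<^sup>+\<theta>. ennreal ((norm (v n (R *\<^sub>R e_r \<theta>) - R *\<^sub>R e_r \<theta>))\<^sup>2) \<partial>lebesgue_on {0..2*pi}) < ennreal \<epsilon>"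
      using order_tendstoD(2)[OF D, of "ennreal \<epsilon>"] order_tendstoD(2)[OF T, of "ennreal \<epsilon>"] \<epsilon>
      by (simp add: eventually_conj)
    then obtain n where n: "(\<integral>\<^sup>+x. ennreal ((norm (v n x - u x))\<^sup>2 +
               (norm (matrix (frechet_derivative (v n) (at x)) - G x))\<^sup>2) \<partial>lebesgue_on A) \<le> ennreal \<epsilon>"
        "(\<integral>\<^sup>+\<theta>. ennreal ((norm (v n (R *\<^sub>R e_r \<theta>) - R *\<^sub>R e_r \<theta>))\<^sup>2) \<partial>lebesgue_on {0..2*pi}) \<le> ennreal \<epsilon>"
      by (metis (no_types, lifting) eventually_happens' less_imp_le sequentially_bot)
    let ?M = "\<lambda>x. matrix (frechet_derivative (v n) (at x))"
    have [measurable]: "v n \<in> borel_measurable (lebesgue_on A)" "?M \<in> borel_measurable (lebesgue_on A)"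
      using A v by (auto intro!: continuous_imp_measurable_on_sets_lebesgue C1_map_continuous_on
          continuous_on_matrix_frechet_derivative)
    have 1: "(\<integral>\<^sup>+x\<in>annulus \<alpha> \<beta>. ennreal ((\<rho> (norm x) - norm (v n x))\<^sup>2) \<partial>lborel) \<le> ennreal \<epsilon>"
    proof -
      have "(\<integral>\<^sup>+x\<in>annulus \<alpha> \<beta>. ennreal ((\<rho> (norm x) - norm (v n x))\<^sup>2) \<partial>lborel)
          \<le> (\<integral>\<^sup>+x\<in>A. ennreal ((\<rho> (norm x) - norm (v n x))\<^sup>2) \<partial>lborel)"
        using sub by (intro nn_integral_mono) (auto simp: indicator_def)
      also have "\<dots> = (\<integral>\<^sup>+x. ennreal ((\<rho> (norm x) - norm (v n x))\<^sup>2) \<partial>lebesgue_on A)"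
        by (rule set_nn_integral_lborel_eq_lebesgue_on[OF A])
      also have "\<dots> \<le> (\<integral>\<^sup>+x. ennreal ((norm (v n x - u x))\<^sup>2 + (norm (?M x - G x))\<^sup>2) \<partial>lebesgue_on A)"
      proof (rule nn_integral_mono_AE)
        show "AE x in lebesgue_on A. ennreal ((\<rho> (norm x) - norm (v n x))\<^sup>2)
            \<le> ennreal ((norm (v n x - u x))\<^sup>2 + (norm (?M x - G x))\<^sup>2)"
          using mod unfolding A_def[symmetric]
        proof eventually_elim
          case (elim x)
          have "\<bar>norm (u x) - norm (v n x)\<bar> \<le> norm (v n x - u x)"
            by (metis norm_minus_commute norm_triangle_ineq3)
          then have "(\<rho> (norm x) - norm (v n x))\<^sup>2 \<le> (norm (v n x - u x))\<^sup>2"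
            using elim by (simp add: abs_le_square_iff[symmetric])
          then show ?case by (intro ennreal_leI) (simp add: add_increasing2)
        qed
      qed
      finally show ?thesis using n(1) by (rule order_trans)
    qed
    have 2: "(\<integral>\<^sup>+x\<in>annulus \<alpha> \<beta>. ennreal ((norm (?M x))\<^sup>2) \<partial>lborel) \<le> ennreal (2 * \<epsilon> + 2 * K)"
    proof -
      have "(\<integral>\<^sup>+x\<in>annulus \<alpha> \<beta>. ennreal ((norm (?M x))\<^sup>2) \<partial>lborel) \<le> (\<integral>\<^sup>+x\<in>A. ennreal ((norm (?M x))\<^sup>2) \<partial>lborel)"
        using sub by (intro nn_integral_mono) (auto simp: indicator_def)
      also have "\<dots> = (\<integral>\<^sup>+x. ennreal ((norm (?M x))\<^sup>2) \<partial>lebesgue_on A)"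
        by (rule set_nn_integral_lborel_eq_lebesgue_on[OF A])
      also have "\<dots> \<le> (\<integral>\<^sup>+x. 2 * ennreal ((norm (v n x - u x))\<^sup>2 + (norm (?M x - G x))\<^sup>2)
          + 2 * ennreal ((norm (G x))\<^sup>2) \<partial>lebesgue_on A)"
      proof (rule nn_integral_mono)
        fix x
        have "norm (?M x) \<le> norm (?M x - G x) + norm (G x)"
          using norm_triangle_ineq[of "?M x - G x" "G x"] by simp
        then have "(norm (?M x))\<^sup>2 \<le> (norm (?M x - G x) + norm (G x))\<^sup>2"
          by (rule power_mono) simp
        also have "\<dots> \<le> 2 * (norm (?M x - G x))\<^sup>2 + 2 * (norm (G x))\<^sup>2"
          using sum_squares_bound[of "norm (?M x - G x)" "norm (G x)"] by (simp add: power2_sum)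
        finally have "(norm (?M x))\<^sup>2 \<le> 2 * ((norm (v n x - u x))\<^sup>2 + (norm (?M x - G x))\<^sup>2) + 2 * (norm (G x))\<^sup>2"
          by (rule order_trans) simp
        then have "ennreal ((norm (?M x))\<^sup>2)
            \<le> ennreal (2 * ((norm (v n x - u x))\<^sup>2 + (norm (?M x - G x))\<^sup>2) + 2 * (norm (G x))\<^sup>2)"
          by (rule ennreal_leI)
        then show "ennreal ((norm (?M x))\<^sup>2) \<le> 2 * ennreal ((norm (v n x - u x))\<^sup>2 + (norm (?M x - G x))\<^sup>2)
            + 2 * ennreal ((norm (G x))\<^sup>2)"
          by (simp add: ennreal_plus ennreal_mult del: ennreal_plus[symmetric])
      qed
      also have "\<dots> = 2 * (\<integral>\<^sup>+x. ennreal ((norm (v n x - u x))\<^sup>2 + (norm (?M x - G x))\<^sup>2) \<partial>lebesgue_on A) + 2 * ennreal K"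
        by (simp add: nn_integral_add nn_integral_cmult K)
      also have "\<dots> \<le> 2 * ennreal \<epsilon> + 2 * ennreal K"
        by (intro add_right_mono mult_left_mono n(1)) simp
      also have "\<dots> = ennreal (2 * \<epsilon> + 2 * K)"
        using K(2) \<epsilon> by (simp add: ennreal_plus ennreal_mult)
      finally show ?thesis .
    qed
    have 3: "(\<integral>\<^sup>+\<theta>\<in>{0<..<2*pi}. ennreal ((norm (v n (R *\<^sub>R e_r \<theta>) - R *\<^sub>R e_r \<theta>))\<^sup>2) \<partial>lborel) \<le> ennreal \<epsilon>"
    proof -
      have "(\<integral>\<^sup>+\<theta>\<in>{0<..<2*pi}. ennreal ((norm (v n (R *\<^sub>R e_r \<theta>) - R *\<^sub>R e_r \<theta>))\<^sup>2) \<partial>lborel)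
          \<le> (\<integral>\<^sup>+\<theta>\<in>{0..2*pi}. ennreal ((norm (v n (R *\<^sub>R e_r \<theta>) - R *\<^sub>R e_r \<theta>))\<^sup>2) \<partial>lborel)"
        by (intro nn_integral_mono) (auto simp: indicator_def)
      then show ?thesis using n(2) by (simp add: set_nn_integral_lborel_eq_lebesgue_on order_trans)
    qed
    have "ennreal (8 * pi * \<mu>\<^sup>2 * L * \<alpha>)
        \<le> ennreal \<epsilon> + ennreal (L\<^sup>2) * ennreal (2 * \<epsilon> + 2 * K) + ennreal (\<alpha> * L) * ennreal \<epsilon>"
    proof (rule order_trans[OF _ add_mono[OF add_mono[OF 1 mult_left_mono[OF 2]] mult_left_mono[OF 3]]])
      show "ennreal (8 * pi * \<mu>\<^sup>2 * L * \<alpha>)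
        \<le> (\<integral>\<^sup>+x\<in>annulus \<alpha> \<beta>. ennreal ((\<rho> (norm x) - norm (v n x))\<^sup>2) \<partial>lborel)
          + ennreal (L\<^sup>2) * (\<integral>\<^sup>+x\<in>annulus \<alpha> \<beta>. ennreal ((norm (?M x))\<^sup>2) \<partial>lborel)
          + ennreal (\<alpha> * L) * (\<integral>\<^sup>+\<theta>\<in>{0<..<2*pi}. ennreal ((norm (v n (R *\<^sub>R e_r \<theta>) - R *\<^sub>R e_r \<theta>))\<^sup>2) \<partial>lborel)"
        unfolding \<alpha>(5)[symmetric]
      proof (rule nn_integral_trace_bound[OF v _ \<alpha>(2,4) \<mu> _ far])
        show "continuous_on {\<alpha><..<\<beta>} \<rho>"
          using cont by (rule continuous_on_subset) (use \<alpha> in auto)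
      qed (use \<alpha> ab in auto)
    qed simp_all
    also have "\<dots> = ennreal (\<epsilon> + L\<^sup>2 * (2 * \<epsilon> + 2 * K) + \<alpha> * L * \<epsilon>)"
      using \<epsilon> K(2) L \<alpha>(1) ab by (simp flip: ennreal_mult ennreal_plus)
    finally show ?thesis
      using \<epsilon> K(2) L \<alpha>(1) ab by (subst (asm) ennreal_le_iff) (auto simp: algebra_simps)
  qed
  have "8 * pi * \<mu>\<^sup>2 * L * \<alpha> \<le> 2 * L\<^sup>2 * K"
  proof (rule field_le_epsilon)
    fix e :: real assume "e > 0"
    define c where "c = 1 + 2 * L\<^sup>2 + \<alpha> * L"
    have "\<alpha> * L \<ge> 0" using L(1) \<alpha>(1) ab by simp
    then have "c > 0" unfolding c_def using zero_le_power2[of L] by linarith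
    then show "8 * pi * \<mu>\<^sup>2 * L * \<alpha> \<le> 2 * L\<^sup>2 * K + e"
      using approx[of "e / c"] \<open>e > 0\<close> unfolding c_def[symmetric] by simp
  qed
  moreover have "2 * L\<^sup>2 * K < 8 * pi * \<mu>\<^sup>2 * L * a"
    using mult_strict_left_mono[OF L(4) L(1)] by (simp add: power2_eq_square mult_ac)
  moreover have "8 * pi * \<mu>\<^sup>2 * L * a \<le> 8 * pi * \<mu>\<^sup>2 * L * \<alpha>"
    using \<alpha>(1) L(1) by (intro mult_left_mono) auto
  ultimately show False by linarith
qed


section \<open>Winding along a ray\<close>

text \<open>A nonzero interior value would persist on a ball, which has positive measure; the
  endpoints follow by passing to the closure.\<close>

lemma continuous_AE_zero_imp_zero:
  fixes f :: "real \<Rightarrow> 'a::real_normed_vector"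
  assumes "a < b" and cont: "continuous_on {a..b} f"
    and AE: "AE r in lborel. r \<in> {a<..<b} \<longrightarrow> f r = 0" and r: "r \<in> {a..b}"
  shows "f r = 0"
proof -
  have interior: "f x = 0" if x: "x \<in> {a<..<b}" for x
  proof (rule ccontr)
    assume "f x \<noteq> 0"
    have "open {y \<in> {a<..<b}. f y \<noteq> 0}"
      using continuous_open_preimage[of "{a<..<b}" f "- {0}"] continuous_on_subset[OF cont, of "{a<..<b}"]
      by (auto simp: vimage_def Int_def greaterThanLessThan_subseteq_atLeastAtMost_iff)
    moreover have "x \<in> {y \<in> {a<..<b}. f y \<noteq> 0}" using x \<open>f x \<noteq> 0\<close> by simp
    ultimately obtain e where e: "e > 0" "ball x e \<subseteq> {y \<in> {a<..<b}. f y \<noteq> 0}"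
      by (meson openE)
    have "AE y in lborel. y \<notin> ball x e"
      using AE by eventually_elim (use e in auto)
    then have "emeasure lborel (ball x e) = 0"
      using AE_iff_null_sets[of "ball x e" lborel] by (simp add: null_sets_def)
    then show False using e(1) by (simp add: ball_eq_greaterThanLessThan)
  qed
  have "closure {a<..<b} = {a..b}" using \<open>a < b\<close> by simp
  then show ?thesis
    using continuous_constant_on_closure[of "{a<..<b}" f 0 r] cont interior r by simp
qed

text \<open>After normalization the curve is the constant \<open>e_r \<phi>\<close>, which is not
  \<open>0\<close>.\<close>

lemma winding_const_direction:
  assumes "a < b" and "\<And>r. r \<in> {a..b} \<Longrightarrow> c r \<noteq> 0" and dir: "\<And>r. r \<in> {a..b} \<Longrightarrow> c r = norm (c r) *\<^sub>R e_r \<phi>"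
  shows "wind a b (\<lambda>r. c r /\<^sub>R norm (c r)) = 0"
  unfolding wind_def
proof (rule winding_number_constI)
  show "Complex (e_r \<phi> $ 1) (e_r \<phi> $ 2) \<noteq> 0"
    using sin_zero_abs_cos_one[of \<phi>] by (auto simp: complex_eq_iff)
next
  fix s :: real assume s: "0 \<le> s" "s \<le> 1"
  let ?r = "a + s * (b - a)"
  have "?r \<le> a + 1 * (b - a)"
    using s \<open>a < b\<close> by (intro add_left_mono mult_right_mono) auto
  also have "\<dots> = b" by simp
  finally have "?r \<le> b" .
  moreover have "a \<le> ?r" using s \<open>a < b\<close> by simp
  ultimately have r: "?r \<in> {a..b}" by simp
  have "c ?r /\<^sub>R norm (c ?r) = (norm (c ?r) *\<^sub>R e_r \<phi>) /\<^sub>R norm (c ?r)"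
    using dir[OF r] by simp
  also have "\<dots> = e_r \<phi>" using assms(2)[OF r] by simp
  finally show "Complex ((c ?r /\<^sub>R norm (c ?r)) $ 1) ((c ?r /\<^sub>R norm (c ?r)) $ 2) = Complex (e_r \<phi> $ 1) (e_r \<phi> $ 2)"
    by simp
qed

lemma AE_lebesgue_on_interval_imp_AE_lborel:
  assumes "AE r in lebesgue_on {a..b}. P r"
  shows "AE r in lborel. r \<in> {a<..<b::real} \<longrightarrow> P r"
proof -
  have "AE r in lborel. r \<in> {a..b} \<longrightarrow> P r"
    using assms by (simp add: AE_restrict_space_iff AE_completion_iff)
  then show ?thesis by eventually_elim auto
qed

lemma polar_form_AE_norm:
  assumes "polar_form a b u \<rho> \<psi>"
  shows "AE x in lebesgue_on (annulus a b). norm (u x) = \<rho> (norm x)"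
proof -
  have AE: "AE x in lebesgue_on (annulus a b).
      \<forall>\<theta>. x = norm x *\<^sub>R e_r \<theta> \<longrightarrow> u x = \<rho> (norm x) *\<^sub>R e_r (\<theta> + \<psi> (norm x))"
    using assms by (simp add: polar_form_def)
  show ?thesis
    using AE AE_space
  proof eventually_elim
    case (elim x)
    \<comment> \<open>\<open>polar_form\<close> constrains \<open>u x\<close> only through angles of
      \<open>x\<close>, so one must be exhibited.\<close>
    obtain \<theta> where "x = norm x *\<^sub>R e_r \<theta>"
    proof (cases "x = 0")
      case False
      have "(x $ 1 / norm x)\<^sup>2 + (x $ 2 / norm x)\<^sup>2 = 1"
        using False by (simp add: power_divide norm_vec_def L2_set_def sum_2 add_divide_distrib[symmetric] real_sqrt_pow2)
          (simp add: vec_eq_iff forall_2)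
      then obtain \<theta> where "x $ 1 / norm x = cos \<theta>" "x $ 2 / norm x = sin \<theta>"
        using sincos_total_2pi by metis
      then have "x $ 1 = cos \<theta> * norm x" "x $ 2 = sin \<theta> * norm x"
        using False by (metis nonzero_divide_eq_eq norm_eq_zero)+
      then have "x = norm x *\<^sub>R e_r \<theta>"
        by (simp only: vec_eq_iff forall_2 vector_scaleR_component e_r_nth real_scaleR_def mult.commute)
      then show thesis by (rule that)
    qed (use that in simp)
    moreover have "\<rho> (norm x) \<ge> 0"
      using elim(2) assms by (simp add: polar_form_def annulus_def space_restrict_space)
    ultimately show ?case using elim(1) by (metis abs_of_nonneg mult_1_right norm_e_r norm_scaleR)
  qed
qed

text \<open>The winding condition and, by \<open>AE_annulus_imp_AE_rays\<close>, the polar form hold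
  on almost every ray, so one angle serves for both.\<close>

lemma ray_curve_exists:
  assumes ab: "0 < a" "a < b" and u: "u \<in> admissible a b N" and polar: "polar_form a b u \<rho> \<psi>"
  shows "\<exists>c \<theta>. continuous_on {a..b} c \<and> (\<forall>r\<in>{a..b}. c r \<noteq> 0) \<and>
    (AE r in lborel. r \<in> {a<..<b} \<longrightarrow> c r = \<rho> r *\<^sub>R e_r (\<theta> + \<psi> r)) \<and>
    wind a b (\<lambda>r. c r /\<^sub>R norm (c r)) = of_nat N"
proof -
  have "AE \<theta> in lborel. \<theta> \<in> {0<..<2*pi} \<longrightarrow> ray_winding a b N u \<theta>"
    using u by (intro AE_lebesgue_on_interval_imp_AE_lborel) (simp add: admissible_def)
  moreover have "AE \<theta> in lborel. \<theta> \<in> {0<..<2*pi} \<longrightarrow> (AE r in lborel. r \<in> {a<..<b} \<longrightarrow>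
      (\<forall>\<phi>. r *\<^sub>R e_r \<theta> = norm (r *\<^sub>R e_r \<theta>) *\<^sub>R e_r \<phi> \<longrightarrow>
        u (r *\<^sub>R e_r \<theta>) = \<rho> (norm (r *\<^sub>R e_r \<theta>)) *\<^sub>R e_r (\<phi> + \<psi> (norm (r *\<^sub>R e_r \<theta>)))))"
    using polar by (intro AE_annulus_imp_AE_rays ab) (simp add: polar_form_def)
  ultimately have AE: "AE \<theta> in lborel. \<theta> \<in> {0<..<2*pi} \<longrightarrow> ray_winding a b N u \<theta> \<and>
      (AE r in lborel. r \<in> {a<..<b} \<longrightarrow> u (r *\<^sub>R e_r \<theta>) = \<rho> r *\<^sub>R e_r (\<theta> + \<psi> r))"
  proof eventually_elim
    case (elim \<theta>)
    show ?case
    proof (intro impI conjI)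
      assume \<theta>: "\<theta> \<in> {0<..<2*pi}"
      then show "ray_winding a b N u \<theta>" using elim(1) by blast
      from elim(2)[rule_format, OF \<theta>]
      show "AE r in lborel. r \<in> {a<..<b} \<longrightarrow> u (r *\<^sub>R e_r \<theta>) = \<rho> r *\<^sub>R e_r (\<theta> + \<psi> r)"
        by eventually_elim (use ab in auto)
    qed
  qed
  obtain \<theta> where ray: "ray_winding a b N u \<theta>"
    and u_ray: "AE r in lborel. r \<in> {a<..<b} \<longrightarrow> u (r *\<^sub>R e_r \<theta>) = \<rho> r *\<^sub>R e_r (\<theta> + \<psi> r)"
  \<comment> \<open>Without a good angle the interval \<open>{0<..<2*pi}\<close> would be
    null.\<close>
  proof (rule ccontr)
    assume "\<not> thesis"
    with that have none: "\<not> (ray_winding a b N u \<theta> \<and>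
      (AE r in lborel. r \<in> {a<..<b} \<longrightarrow> u (r *\<^sub>R e_r \<theta>) = \<rho> r *\<^sub>R e_r (\<theta> + \<psi> r)))" for \<theta>
      by blast
    have "AE \<theta> in lborel. \<theta> \<notin> {0<..<2*pi}"
      using AE by eventually_elim (use none in blast)
    then have "emeasure lborel {0<..<2*pi} = 0"
      using AE_iff_null_sets[of "{0<..<2*pi}" lborel] by (simp add: null_sets_def)
    then show False by simp
  qed
  obtain c where c: "continuous_on {a..b} c" "\<forall>r\<in>{a..b}. c r \<noteq> 0"
    "AE r in lebesgue_on {a..b}. c r = u (r *\<^sub>R e_r \<theta>)" "wind a b (\<lambda>r. c r /\<^sub>R norm (c r)) = of_nat N"
    using ray unfolding ray_winding_def by blast
  have "AE r in lborel. r \<in> {a<..<b} \<longrightarrow> c r = \<rho> r *\<^sub>R e_r (\<theta> + \<psi> r)"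
    using AE_lebesgue_on_interval_imp_AE_lborel[OF c(3)] u_ray by eventually_elim auto
  then show ?thesis using c by blast
qed

text \<open>On a good ray \<open>c\<close> has the polar form only almost everywhere, but
  \<open>norm (c r)\<close> and \<open>\<rho>\<close> are continuous, so they agree on all of
  \<open>{a..b}\<close>, where \<open>c\<close> never vanishes. For constant \<open>\<psi>\<close>
  the same argument fixes the direction of \<open>c\<close>, so its winding number would be
  \<open>0\<close> and not \<open>N\<close>.\<close>

lemma polar_form_modulus_pos_twist_nonconstant:
  assumes ab: "0 < a" "a < b" and u: "u \<in> admissible a b N" and N: "1 \<le> N"
    and polar: "polar_form a b u \<rho> \<psi>" and cont: "continuous_on {a..b} \<rho>"
  shows "\<And>r. r \<in> {a<..<b} \<Longrightarrow> \<rho> r > 0" and "\<not> \<psi> constant_on {a<..<b}"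
proof -
  obtain c \<theta> where c: "continuous_on {a..b} c" "\<And>r. r \<in> {a..b} \<Longrightarrow> c r \<noteq> 0"
    and c_eq: "AE r in lborel. r \<in> {a<..<b} \<longrightarrow> c r = \<rho> r *\<^sub>R e_r (\<theta> + \<psi> r)"
    and wind: "wind a b (\<lambda>r. c r /\<^sub>R norm (c r)) = of_nat N"
    using ray_curve_exists[OF ab u polar] by blast
  have \<rho>_nonneg: "\<rho> r \<ge> 0" if "r \<in> {a<..<b}" for r
    using polar that by (simp add: polar_form_def)
  have AE0: "AE r in lborel. r \<in> {a<..<b} \<longrightarrow> norm (c r) - \<rho> r = 0"
    using c_eq by eventually_elim (use \<rho>_nonneg in auto)
  have norm_c: "norm (c r) = \<rho> r" if "r \<in> {a..b}" for r
    using continuous_AE_zero_imp_zero[OF ab(2) _ AE0 that] by (simp add: continuous_on_diff continuous_on_norm c cont)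
  show "\<rho> r > 0" if "r \<in> {a<..<b}" for r
  proof -
    have "r \<in> {a..b}" using that by simp
    then show ?thesis using norm_c c(2) by (metis zero_less_norm_iff)
  qed
  show "\<not> \<psi> constant_on {a<..<b}"
  proof
    assume "\<psi> constant_on {a<..<b}"
    then obtain \<psi>0 where \<psi>0: "\<And>r. r \<in> {a<..<b} \<Longrightarrow> \<psi> r = \<psi>0" by (auto simp: constant_on_def)
    have AE1: "AE r in lborel. r \<in> {a<..<b} \<longrightarrow> c r - norm (c r) *\<^sub>R e_r (\<theta> + \<psi>0) = 0"
      using c_eq by eventually_elim (use \<psi>0 norm_c \<rho>_nonneg in auto)
    have "c r = norm (c r) *\<^sub>R e_r (\<theta> + \<psi>0)" if "r \<in> {a..b}" for r
      using continuous_AE_zero_imp_zero[OF ab(2) _ AE1 that] by (simp add: continuous_intros c)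
    from winding_const_direction[OF ab(2) c(2) this] wind N show False by simp
  qed
qed

section \<open>The shape of \<open>\<rho> / r\<close> for the symmetric minimizer\<close>

theorem theorem10:
  fixes a b :: real and N :: nat and h0 :: "real \<Rightarrow> ennreal"
    and u :: "real^2 \<Rightarrow> real^2" and \<rho> \<psi> :: "real \<Rightarrow> real"
  assumes "0 < a" and "a < b" and "1 \<le> N"
    and "H1 h0" and "H2 h0" and "H3 h0" and "H4 h0"
    and "sym_minimizer h0 a b N u"
    and "polar_form a b u \<rho> \<psi>"
    and "continuous_on {a..b} \<rho>" and "Ck_on 3 \<rho> {a<..<b}" and "Ck_on 2 \<psi> {a<..<b}"
    and "radial_Euler_Lagrange h0 a b \<rho> \<psi>"
  shows "(\<forall>r\<in>{a<..<b}. \<not> local_max_at (\<lambda>r. \<rho> r / r) r) \<and>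
         (\<exists>r0\<in>{a<..<b}.
            (\<forall>r\<in>{a<..<r0}. deriv (\<lambda>r. \<rho> r / r) r < 0) \<and>
            (\<forall>r\<in>{r0<..<b}. deriv (\<lambda>r. \<rho> r / r) r > 0)) \<and>
         (\<forall>r\<in>{a<..<b}. a / b \<le> \<rho> r / r \<and> \<rho> r / r < 1) \<and>
         \<rho> a / a = 1 \<and> \<rho> b / b = 1"
proof -
  note ab = \<open>0 < a\<close> \<open>a < b\<close> and cont = \<open>continuous_on {a..b} \<rho>\<close> and C3 = \<open>Ck_on 3 \<rho> {a<..<b}\<close>
  have u: "u \<in> admissible a b N"
    using \<open>sym_minimizer h0 a b N u\<close> by (simp add: sym_minimizer_def admissible_sym_def)
  then have "u \<in> W12 (annulus a b)" "has_trace a b u (\<lambda>x. x)"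
    by (simp_all add: admissible_def)
  note boundary = has_trace_imp_modulus_boundary[OF ab this polar_form_AE_norm[OF \<open>polar_form a b u \<rho> \<psi>\<close>] cont]
  have \<rho>a: "\<rho> a = a" and \<rho>b: "\<rho> b = b" using boundary by simp_all
  note pos_nonconst = polar_form_modulus_pos_twist_nonconstant[OF ab u \<open>1 \<le> N\<close> \<open>polar_form a b u \<rho> \<psi>\<close> cont]
  note \<rho>_pos = pos_nonconst(1)
  have D: "(\<rho> has_real_derivative deriv \<rho> r) (at r)"
    and D2: "(deriv \<rho> has_real_derivative deriv (deriv \<rho>) r) (at r)"
    and D\<psi>: "(\<psi> has_real_derivative deriv \<psi> r) (at r)" if "r \<in> {a<..<b}" for r
    using Ck_on_deriv[OF C3, of 0 r] Ck_on_deriv[OF C3, of 1 r]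
      Ck_on_deriv[OF \<open>Ck_on 2 \<psi> {a<..<b}\<close>, of 0 r] that by simp_all
  have EL: "((\<lambda>r. r * deriv \<rho> r + \<rho> r * deriv (fin h0) (radial_det \<rho> r)) has_real_derivative
          \<rho> r / r + r * \<rho> r * (deriv \<psi> r)\<^sup>2 + deriv \<rho> r * deriv (fin h0) (radial_det \<rho> r)) (at r)"
    if "r \<in> {a<..<b}" for r
    using \<open>radial_Euler_Lagrange h0 a b \<rho> \<psi>\<close> that by (simp add: radial_Euler_Lagrange_def)
  obtain \<omega> where \<omega>: "\<And>r. r \<in> {a<..<b} \<Longrightarrow> r * (\<rho> r)\<^sup>2 * deriv \<psi> r = \<omega>"
    using \<open>radial_Euler_Lagrange h0 a b \<rho> \<psi>\<close> by (auto simp: radial_Euler_Lagrange_def)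
  have "\<omega> \<noteq> 0"
  proof
    assume "\<omega> = 0"
    then have "deriv \<psi> r = 0" if "r \<in> {a<..<b}" for r
      using \<omega>[OF that] \<rho>_pos[OF that] that ab by auto
    then have "\<psi> constant_on {a<..<b}"
      using D\<psi> by (intro has_field_derivative_0_imp_constant_on) force+
    with pos_nonconst(2) show False by blast
  qed
  then have \<psi>': "deriv \<psi> r \<noteq> 0" if "r \<in> {a<..<b}" for r
    using \<omega>[OF that] by auto
  have d_pos: "radial_det \<rho> r > 0" if "r \<in> {a<..<b}" for r
    using Euler_Lagrange_imp_radial_det_pos[OF ab(2,1) \<open>H2 h0\<close> cont C3 DERIV_isCont[OF EL] \<rho>_pos _ that] \<rho>a \<rho>b ab
    by simp
  have C3h: "Ck_on 3 (fin h0) {0<..}" and h_fin: "\<And>t. t > 0 \<Longrightarrow> h0 t < \<infinity>"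
    using \<open>H2 h0\<close> by (auto simp: H2_def)
  have h': "(fin h0 has_real_derivative deriv (fin h0) t) (at t)"
    and h'': "(deriv (fin h0) has_real_derivative deriv (deriv (fin h0)) t) (at t)" if "t \<in> {0<..}" for t
    using Ck_on_deriv[OF C3h, of 0 t] Ck_on_deriv[OF C3h, of 1 t] that by simp_all
  have convex: "deriv (deriv (fin h0)) t \<ge> 0" if "t \<in> {0<..}" for t
    using convex_on_second_deriv_nonneg[OF open_greaterThan _ H1_convex_on_fin[OF \<open>H1 h0\<close> h_fin] h' h''[OF that] that]
    by simp
  define \<sigma> where "\<sigma> = (\<lambda>r. \<rho> r / r)"
  define \<sigma>' where "\<sigma>' = (\<lambda>r. (r * deriv \<rho> r - \<rho> r) / r\<^sup>2)"
  \<comment> \<open>The second term vanishes at critical points of \<open>\<sigma>\<close>, where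
    \<open>\<sigma>''\<close> thus has the sign of \<open>\<rho>''\<close>.\<close>
  define \<sigma>'' where "\<sigma>'' = (\<lambda>r. deriv (deriv \<rho>) r / r - 2 * (r * deriv \<rho> r - \<rho> r) / r ^ 3)"
  have \<sigma>: "(\<sigma> has_real_derivative \<sigma>' r) (at r)" if "r \<in> {a<..<b}" for r
    unfolding \<sigma>_def \<sigma>'_def using that ab
    by (auto intro!: derivative_eq_intros D simp: power2_eq_square)
  have \<sigma>': "(\<sigma>' has_real_derivative \<sigma>'' r) (at r)" if "r \<in> {a<..<b}" for r
    unfolding \<sigma>'_def \<sigma>''_def using that ab
    by (auto intro!: derivative_eq_intros D D2 simp: power2_eq_square power3_eq_cube field_simps)
  have crit: "\<sigma>'' r > 0" if r: "r \<in> {a<..<b}" and "\<sigma>' r = 0" for r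
  proof -
    have "r > 0" using r ab by simp
    have crit: "r * deriv \<rho> r = \<rho> r" using \<open>\<sigma>' r = 0\<close> \<open>r > 0\<close> by (simp add: \<sigma>'_def)
    have "deriv (deriv \<rho>) r > 0"
    proof (rule Euler_Lagrange_second_deriv_pos[OF \<open>r > 0\<close> d_pos[OF r] \<rho>_pos[OF r] _ D2[OF r] h'' convex EL[OF r] crit \<psi>'[OF r]])
      show "\<forall>\<^sub>F t in nhds r. (\<rho> has_real_derivative deriv \<rho> t) (at t)"
        using eventually_nhds_in_open[OF open_greaterThanLessThan r] by eventually_elim (rule D)
    qed (use d_pos[OF r] in auto)
    then show ?thesis using \<open>r > 0\<close> by (simp add: \<sigma>''_def crit)
  qed
  have \<sigma>_cont: "continuous_on {a..b} \<sigma>"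
    unfolding \<sigma>_def using ab cont by (intro continuous_intros) auto
  have \<sigma>_ends: "\<sigma> a = 1" "\<sigma> b = 1" using ab by (simp_all add: \<sigma>_def \<rho>a \<rho>b)
  then have "\<sigma> a = \<sigma> b" by simp
  note shape = pos_second_deriv_at_critical_points_shape[OF ab(2) \<sigma>_cont this \<sigma> \<sigma>' crit]
  \<comment> \<open>A positive determinant makes \<open>\<rho>\<close> increasing, so
    \<open>\<rho> r \<ge> a\<close>, while \<open>r < b\<close>.\<close>
  have lower: "a / b \<le> \<sigma> r" if r: "r \<in> {a<..<b}" for r
  proof -
    have "\<rho> a \<le> \<rho> r"
    proof (rule DERIV_nonneg_imp_increasing_open[of a r \<rho>])
      show "\<exists>y. (\<rho> has_real_derivative y) (at x) \<and> 0 \<le> y" if "a < x" "x < r" for x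
      proof -
        have x: "x \<in> {a<..<b}" using that r by simp
        have "deriv \<rho> x > 0"
          using d_pos[OF x] \<rho>_pos[OF x] x ab by (simp add: radial_det_def zero_less_divide_iff zero_less_mult_iff)
        then show ?thesis using D[OF x] by auto
      qed
    qed (use r in \<open>auto intro: continuous_on_subset[OF cont]\<close>)
    then show ?thesis using r ab by (auto simp: \<sigma>_def \<rho>a intro!: frac_le)
  qed
  have sign: "\<exists>r0\<in>{a<..<b}. (\<forall>r\<in>{a<..<r0}. deriv \<sigma> r < 0) \<and> (\<forall>r\<in>{r0<..<b}. deriv \<sigma> r > 0)"
  proof -
    have deriv: "deriv \<sigma> r = \<sigma>' r" if "r \<in> {a<..<b}" for r
      using \<sigma>[OF that] by (rule DERIV_imp_deriv)
    obtain r0 where "r0 \<in> {a<..<b}" "\<forall>r\<in>{a<..<r0}. \<sigma>' r < 0" "\<forall>r\<in>{r0<..<b}. \<sigma>' r > 0"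
      using shape(1) by blast
    then show ?thesis by (intro bexI[of _ r0]) (auto simp: deriv)
  qed
  have no_max: "\<forall>r\<in>{a<..<b}. \<not> local_max_at \<sigma> r"
    using shape(3) by blast
  have "\<forall>r\<in>{a<..<b}. a / b \<le> \<sigma> r \<and> \<sigma> r < 1"
    using lower shape(2)[unfolded \<sigma>_ends(1)] by blast
  with no_max sign \<sigma>_ends show ?thesis
    unfolding \<sigma>_def by (intro conjI)
qed

end
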